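(* For any $0\le p<n$, $$\gamma_p(dx_p)\;\mathcal Q_{p,n}(x_p,d(x_{p+1},\dots,x_n))=\gamma_n(dx_n)\;\mathcal M_{n,p}(x_n,d(x_p,\dots,x_{n-1}))$$ as measures on $E_p\times\cdots\times E_n$, where $$\mathcal M_{n,p}(x_n,d(x_p,\dots,x_{n-1})):=\prod_{p\le q<n}M_{q+1,\eta_q}(x_{q+1},dx_q).$$ In particular, for any $n\ge0$, the Feynman-Kac path measure $\mathbb Q_n$ has the backward Markov chain formulation $$\mathbb Q_n(d(x_0,\dots,x_n))=\eta_n(dx_n)\;\mathcal M_{n,0}(x_n,d(x_0,\dots,x_{n-1})).$$
   Context: $(E_n)_{n\ge0}$ are measurable spaces. $(X_n)_{n\ge 0}$ is a Markov chain with $X_n\in E_n$, initial law $\eta_0$ and Markov transitions $M_n(x_{n-1},dx_n)$ from $E_{n-1}$ into $E_n$. $G_n:E_n\to(0,1]$ are measurable. Standing assumption: $M_n(x,dy)=H_n(x,y)\lambda_n(dy)$ for some ($\sigma$-finite) measure $\lambda_n$ on $E_n$ and some measurable $H_n:E_{n-1}\times E_n\to(0,\infty)$. For bounded measurable functions, $\mathbb Q_n(F_n)=\dfrac{\mathbb E\big(F_n(X_0,\dots,X_n)\prod_{0\le p<n}G_p(X_p)\big)}{\mathbb E\big(\prod_{0\le p<n}G_p(X_p)\big)}$ (a probability on $E_0\times\cdots\times E_n$); $\gamma_n(f)=\mathbb E\big(f(X_n)\prod_{0\le p<n}G_p(X_p)\big)$, $\eta_n=\gamma_n/\gamma_n(1)$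 (on $E_n$). $Q_n(x,dy)=G_{n-1}(x)M_n(x,dy)$ and $\mathcal Q_{p,n}(x_p,d(x_{p+1},\dots,x_n))=\prod_{p\le q<n}Q_{q+1}(x_q,dx_{q+1})$. For a probability $\eta$ on $E_n$, $M_{n+1,\eta}$ is the Markov transition from $E_{n+1}$ into $E_n$ $$M_{n+1,\eta}(x,dy)=\frac{G_n(y)H_{n+1}(y,x)\,\eta(dy)}{\eta(G_nH_{n+1}(\cdot,x))},\qquad \eta(g)=\int g\,d\eta$$ (the denominator is positive, and finite for $\lambda_{n+1}$-almost every $x$; on the exceptional null set any fixed choice of probability is made). For $n=0$ the kernel $\mathcal M_{0,0}$ is trivial (empty product). *)

theory Defs
  imports "HOL-Probability.Probability"
begin

text \<open>
  A sequence of measurable spaces is \<open>E :: nat \<Rightarrow> 'a measure\<close>; only \<open>space (E n)\<close> and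
  \<open>sets (E n)\<close> matter. A point of \<open>E\<^sub>p \<times> \<dots> \<times> E\<^sub>n\<close> is an element of
  \<open>space (Pi\<^sub>M {p..n} E)\<close>. Families indexed by \<open>n \<ge> 1\<close> in the mathematics (\<open>M\<^sub>n\<close>, \<open>H\<^sub>n\<close>, \<open>\<lambda>\<^sub>n\<close>,
  \<open>Q\<^sub>n\<close>) are total functions of \<open>n\<close> whose value at \<open>0\<close> is never used.
\<close>

definition history ::
  "'w measure \<Rightarrow> (nat \<Rightarrow> 'a measure) \<Rightarrow> (nat \<Rightarrow> 'w \<Rightarrow> 'a) \<Rightarrow> nat \<Rightarrow> 'w measure" where
  "history P E X n =
     vimage_algebra (space P) (\<lambda>\<omega>. \<lambda>i\<in>{0..n}. X i \<omega>) (Pi\<^sub>M {0..n} E)"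

definition markov_chain ::
  "'w measure \<Rightarrow> (nat \<Rightarrow> 'a measure) \<Rightarrow> (nat \<Rightarrow> 'w \<Rightarrow> 'a) \<Rightarrow> 'a measure
    \<Rightarrow> (nat \<Rightarrow> 'a \<Rightarrow> 'a measure) \<Rightarrow> bool" where
  "markov_chain P E X \<eta>0 M \<longleftrightarrow>
     prob_space P \<and>
     (\<forall>n. X n \<in> P \<rightarrow>\<^sub>M E n) \<and>
     (\<forall>n. M (Suc n) \<in> E n \<rightarrow>\<^sub>M prob_algebra (E (Suc n))) \<and>
     distr P (E 0) (X 0) = \<eta>0 \<and>
     (\<forall>n. \<forall>A\<in>sets (E (Suc n)). AE \<omega> in P.
        real_cond_exp P (history P E X n) (\<lambda>\<omega>. indicator A (X (Suc n) \<omega>)) \<omega>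
          = measure (M (Suc n) (X n \<omega>)) A)"

definition FK_weight ::
  "(nat \<Rightarrow> 'w \<Rightarrow> 'a) \<Rightarrow> (nat \<Rightarrow> 'a \<Rightarrow> real) \<Rightarrow> nat \<Rightarrow> 'w \<Rightarrow> real" where
  "FK_weight X G n \<omega> = (\<Prod>p<n. G p (X p \<omega>))"

text \<open>
  The measures \<open>\<gamma>\<^sub>n\<close>, \<open>\<eta>\<^sub>n\<close> and \<open>\<bbbQ>\<^sub>n\<close>. The lemmas \<open>integral_FK_gamma\<close> and \<open>integral_FK_path\<close>
  below recover the usual expectation formulas for \<open>\<gamma>\<^sub>n(f)\<close> and \<open>\<bbbQ>\<^sub>n(F)\<close>.
\<close>

definition FK_gamma ::
  "'w measure \<Rightarrow> (nat \<Rightarrow> 'a measure) \<Rightarrow> (nat \<Rightarrow> 'w \<Rightarrow> 'a) \<Rightarrow> (nat \<Rightarrow> 'a \<Rightarrow> real)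
    \<Rightarrow> nat \<Rightarrow> 'a measure" where
  "FK_gamma P E X G n = distr (density P (\<lambda>\<omega>. ennreal (FK_weight X G n \<omega>))) (E n) (X n)"

definition FK_eta ::
  "'w measure \<Rightarrow> (nat \<Rightarrow> 'a measure) \<Rightarrow> (nat \<Rightarrow> 'w \<Rightarrow> 'a) \<Rightarrow> (nat \<Rightarrow> 'a \<Rightarrow> real)
    \<Rightarrow> nat \<Rightarrow> 'a measure" where
  "FK_eta P E X G n =
     scale_measure (1 / emeasure (FK_gamma P E X G n) (space (E n))) (FK_gamma P E X G n)"

definition FK_path ::
  "'w measure \<Rightarrow> (nat \<Rightarrow> 'a measure) \<Rightarrow> (nat \<Rightarrow> 'w \<Rightarrow> 'a) \<Rightarrow> (nat \<Rightarrow> 'a \<Rightarrow> real)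
    \<Rightarrow> nat \<Rightarrow> (nat \<Rightarrow> 'a) measure" where
  "FK_path P E X G n =
     distr (density P (\<lambda>\<omega>. ennreal (FK_weight X G n \<omega> / (\<integral>\<omega>'. FK_weight X G n \<omega>' \<partial>P))))
       (Pi\<^sub>M {0..n} E) (\<lambda>\<omega>. \<lambda>i\<in>{0..n}. X i \<omega>)"

definition FK_kernel ::
  "(nat \<Rightarrow> 'a \<Rightarrow> real) \<Rightarrow> (nat \<Rightarrow> 'a \<Rightarrow> 'a measure) \<Rightarrow> nat \<Rightarrow> 'a \<Rightarrow> 'a measure" where
  "FK_kernel G M n x = scale_measure (ennreal (G (n - 1) x)) (M n x)"

text \<open>
  \<open>forward_product E Q p n x\<close> is the measure \<open>\<Prod>\<^bsub>p\<le>q<n\<^esub> Q\<^sub>q\<^sub>+\<^sub>1(x\<^sub>q, dx\<^sub>q\<^sub>+\<^sub>1)\<close> on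
  \<open>E\<^sub>p\<^sub>+\<^sub>1 \<times> \<dots> \<times> E\<^sub>n\<close> started at \<open>x\<^sub>p = x\<close>, with
  \<open>Q\<^sub>p\<^sub>+\<^sub>1(x\<^sub>p, dx\<^sub>p\<^sub>+\<^sub>1)\<close> split off; the empty product is the unit mass at the empty path.
\<close>

function forward_product ::
  "(nat \<Rightarrow> 'a measure) \<Rightarrow> (nat \<Rightarrow> 'a \<Rightarrow> 'a measure) \<Rightarrow> nat \<Rightarrow> nat \<Rightarrow> 'a
    \<Rightarrow> (nat \<Rightarrow> 'a) measure" where
  "forward_product E Q p n x =
     (if p < n
      then Q (Suc p) x \<bind> (\<lambda>y. distr (forward_product E Q (Suc p) n y)
                                  (Pi\<^sub>M {p<..n} E) (\<lambda>z. z(Suc p := y)))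
      else return (Pi\<^sub>M {} E) (\<lambda>_. undefined))"
  by pat_completeness auto
termination
  by (relation "Wellfounded.measure (\<lambda>(E, Q, p, n, x). n - p)") auto

declare forward_product.simps [simp del]

text \<open>
  \<open>backward_product E K p n x\<close> is the measure \<open>\<Prod>\<^bsub>p\<le>q<n\<^esub> K\<^sub>q(x\<^sub>q\<^sub>+\<^sub>1, dx\<^sub>q)\<close> on
  \<open>E\<^sub>p \<times> \<dots> \<times> E\<^sub>n\<^sub>-\<^sub>1\<close> started at \<open>x\<^sub>n = x\<close>, where \<open>K q\<close> is a transition from \<open>E (Suc q)\<close> into
  \<open>E q\<close>.
\<close>

primrec backward_product ::
  "(nat \<Rightarrow> 'a measure) \<Rightarrow> (nat \<Rightarrow> 'a \<Rightarrow> 'a measure) \<Rightarrow> nat \<Rightarrow> nat \<Rightarrow> 'a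
    \<Rightarrow> (nat \<Rightarrow> 'a) measure" where
  "backward_product E K p 0 x = return (Pi\<^sub>M {} E) (\<lambda>_. undefined)"
| "backward_product E K p (Suc n) x =
     (if p \<le> n
      then K n x \<bind> (\<lambda>y. distr (backward_product E K p n y)
                            (Pi\<^sub>M {p..<Suc n} E) (\<lambda>z. z(n := y)))
      else return (Pi\<^sub>M {} E) (\<lambda>_. undefined))"

text \<open>
  \<open>M\<^sub>n\<^sub>+\<^sub>1\<^sub>,\<^sub>\<eta>(x, dy)\<close>; the probability \<open>\<nu> x\<close> is the choice made at the points \<open>x\<close> where
  \<open>\<eta>(G\<^sub>n H\<^sub>n\<^sub>+\<^sub>1(\<cdot>, x))\<close> is infinite.
\<close>

definition backward_kernel ::
  "(nat \<Rightarrow> 'a \<Rightarrow> real) \<Rightarrow> (nat \<Rightarrow> 'a \<Rightarrow> 'a \<Rightarrow> real) \<Rightarrow> ('a \<Rightarrow> 'a measure) \<Rightarrow> nat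
    \<Rightarrow> 'a measure \<Rightarrow> 'a \<Rightarrow> 'a measure" where
  "backward_kernel G H \<nu> n \<eta> x =
     (let D = (\<integral>\<^sup>+y. ennreal (G n y * H (Suc n) y x) \<partial>\<eta>)
      in if D < \<infinity> then density \<eta> (\<lambda>y. ennreal (G n y * H (Suc n) y x) / D) else \<nu> x)"

definition FK_forward ::
  "(nat \<Rightarrow> 'a measure) \<Rightarrow> (nat \<Rightarrow> 'a \<Rightarrow> real) \<Rightarrow> (nat \<Rightarrow> 'a \<Rightarrow> 'a measure)
    \<Rightarrow> nat \<Rightarrow> nat \<Rightarrow> 'a \<Rightarrow> (nat \<Rightarrow> 'a) measure" where
  "FK_forward E G M p n = forward_product E (FK_kernel G M) p n"

definition FK_backward ::
  "'w measure \<Rightarrow> (nat \<Rightarrow> 'a measure) \<Rightarrow> (nat \<Rightarrow> 'w \<Rightarrow> 'a) \<Rightarrow> (nat \<Rightarrow> 'a \<Rightarrow> real)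
    \<Rightarrow> (nat \<Rightarrow> 'a \<Rightarrow> 'a \<Rightarrow> real) \<Rightarrow> (nat \<Rightarrow> 'a \<Rightarrow> 'a measure)
    \<Rightarrow> nat \<Rightarrow> nat \<Rightarrow> 'a \<Rightarrow> (nat \<Rightarrow> 'a) measure" where
  "FK_backward P E X G H \<nu> n p =
     backward_product E (\<lambda>q. backward_kernel G H (\<nu> q) q (FK_eta P E X G q)) p n"

lemma FK_weight_measurable:
  assumes "\<And>n. X n \<in> P \<rightarrow>\<^sub>M E n" and "\<And>n. G n \<in> borel_measurable (E n)"
  shows "FK_weight X G n \<in> borel_measurable P"
proof -
  have "(\<lambda>\<omega>. G p (X p \<omega>)) \<in> borel_measurable P" for p
    by (rule measurable_compose[OF assms(1) assms(2)])
  then show ?thesis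
    unfolding FK_weight_def[abs_def] by (intro borel_measurable_prod) auto
qed

lemma FK_weight_nonneg:
  assumes "\<And>n. X n \<in> P \<rightarrow>\<^sub>M E n" and "\<And>n. G n \<in> space (E n) \<rightarrow> {0<..1}"
    and "\<omega> \<in> space P"
  shows "0 \<le> FK_weight X G n \<omega>"
  unfolding FK_weight_def
  by (intro prod_nonneg)
     (use assms measurable_space[OF assms(1)] in \<open>fastforce simp: Pi_iff intro: less_imp_le\<close>)

lemma integral_FK_gamma:
  fixes f :: "'a \<Rightarrow> real"
  assumes X: "\<And>n. X n \<in> P \<rightarrow>\<^sub>M E n"
    and G: "\<And>n. G n \<in> borel_measurable (E n)" "\<And>n. G n \<in> space (E n) \<rightarrow> {0<..1}"
    and f: "f \<in> borel_measurable (E n)"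
  shows "(\<integral>x. f x \<partial>FK_gamma P E X G n) = (\<integral>\<omega>. f (X n \<omega>) * (\<Prod>p<n. G p (X p \<omega>)) \<partial>P)"
proof -
  have [measurable]: "FK_weight X G n \<in> borel_measurable P"
    by (rule FK_weight_measurable[OF X G(1)])
  have [measurable]: "(\<lambda>\<omega>. f (X n \<omega>)) \<in> borel_measurable P"
    by (rule measurable_compose[OF X f])
  have "(\<integral>x. f x \<partial>FK_gamma P E X G n)
      = (\<integral>\<omega>. f (X n \<omega>) \<partial>density P (\<lambda>\<omega>. ennreal (FK_weight X G n \<omega>)))"
    unfolding FK_gamma_def by (rule integral_distr) (use X f in auto)
  also have "\<dots> = (\<integral>\<omega>. FK_weight X G n \<omega> *\<^sub>R f (X n \<omega>) \<partial>P)"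
    by (rule integral_density) (auto intro!: AE_I2 FK_weight_nonneg[OF X G(2)])
  finally show ?thesis by (simp add: FK_weight_def mult.commute)
qed

lemma integral_FK_path:
  fixes F :: "(nat \<Rightarrow> 'a) \<Rightarrow> real"
  assumes X: "\<And>n. X n \<in> P \<rightarrow>\<^sub>M E n"
    and G: "\<And>n. G n \<in> borel_measurable (E n)" "\<And>n. G n \<in> space (E n) \<rightarrow> {0<..1}"
    and F: "F \<in> borel_measurable (Pi\<^sub>M {0..n} E)"
  shows "(\<integral>x. F x \<partial>FK_path P E X G n)
    = (\<integral>\<omega>. F (\<lambda>i\<in>{0..n}. X i \<omega>) * (\<Prod>p<n. G p (X p \<omega>)) \<partial>P)
        / (\<integral>\<omega>. (\<Prod>p<n. G p (X p \<omega>)) \<partial>P)"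
proof -
  let ?Z = "\<integral>\<omega>. FK_weight X G n \<omega> \<partial>P"
  have [measurable]: "FK_weight X G n \<in> borel_measurable P"
    by (rule FK_weight_measurable[OF X G(1)])
  have path: "(\<lambda>\<omega>. \<lambda>i\<in>{0..n}. X i \<omega>) \<in> P \<rightarrow>\<^sub>M Pi\<^sub>M {0..n} E"
    by (rule measurable_restrict) (rule X)
  have [measurable]: "(\<lambda>\<omega>. F (\<lambda>i\<in>{0..n}. X i \<omega>)) \<in> borel_measurable P"
    by (rule measurable_compose[OF path F])
  have Z: "0 \<le> ?Z"
    by (rule integral_nonneg_AE) (auto intro!: AE_I2 FK_weight_nonneg[OF X G(2)])
  have "(\<integral>x. F x \<partial>FK_path P E X G n)
      = (\<integral>\<omega>. F (\<lambda>i\<in>{0..n}. X i \<omega>) \<partial>density P (\<lambda>\<omega>. ennreal (FK_weight X G n \<omega> / ?Z)))"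
    unfolding FK_path_def by (rule integral_distr) (use path F in auto)
  also have "\<dots> = (\<integral>\<omega>. (FK_weight X G n \<omega> / ?Z) *\<^sub>R F (\<lambda>i\<in>{0..n}. X i \<omega>) \<partial>P)"
    by (rule integral_density)
       (auto intro!: AE_I2 divide_nonneg_nonneg FK_weight_nonneg[OF X G(2)] Z)
  also have "\<dots> = (\<integral>\<omega>. (F (\<lambda>i\<in>{0..n}. X i \<omega>) * FK_weight X G n \<omega>) / ?Z \<partial>P)"
    by (simp add: mult.commute)
  finally show ?thesis by (simp add: FK_weight_def)
qed

lemma FK_eta_0:
  assumes "markov_chain P E X \<eta>0 M"
  shows "FK_eta P E X G 0 = \<eta>0"
proof -
  interpret prob_space P using assms by (simp add: markov_chain_def)
  have X: "X 0 \<in> P \<rightarrow>\<^sub>M E 0" and \<eta>0: "distr P (E 0) (X 0) = \<eta>0"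
    using assms by (auto simp: markov_chain_def)
  interpret D: prob_space \<eta>0 unfolding \<eta>0[symmetric] by (rule prob_space_distr[OF X])
  have g: "FK_gamma P E X G 0 = \<eta>0"
    by (simp add: FK_gamma_def FK_weight_def density_1 \<eta>0)
  have "space \<eta>0 = space (E 0)" using \<eta>0 by auto
  then have "emeasure \<eta>0 (space (E 0)) = 1" using D.emeasure_space_1 by simp
  then show ?thesis by (simp add: FK_eta_def g)
qed

end

theory Submission imports Defs begin

text \<open>
  Both sides of the identity integrate a function \<open>f\<close> on \<open>E\<^sub>p \<times> \<dots> \<times> E\<^sub>n\<close> to
  \<open>\<bbbE>(f(X\<^sub>p, \<dots>, X\<^sub>n) \<Prod>\<^bsub>q<n\<^esub> G\<^sub>q(X\<^sub>q))\<close>. For the forward side this is the Markov property, applied by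
  induction on \<open>n - p\<close>. For the backward side one uses the duality
  \<open>\<gamma>\<^sub>n\<^sub>+\<^sub>1(dx) M\<^bsub>n+1,\<eta>\<^sub>n\<^esub>(x, dy) = \<gamma>\<^sub>n(dy) Q\<^sub>n\<^sub>+\<^sub>1(y, dx)\<close>: the measure \<open>\<gamma>\<^sub>n\<^sub>+\<^sub>1\<close> has density
  \<open>x \<mapsto> \<gamma>\<^sub>n(G\<^sub>n H\<^sub>n\<^sub>+\<^sub>1(\<cdot>, x))\<close> with respect to \<open>\<lambda>\<^sub>n\<^sub>+\<^sub>1\<close>, which cancels the normalisation of the backward
  kernel; being integrable, it is finite almost everywhere, so the arbitrary choice \<open>\<nu>\<close> has no influence.
\<close>

section \<open>Adding a coordinate to a kernel on a product space\<close>

text \<open>Indicators would suffice; integrals of arbitrary functions fit the computations below,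
  which evaluate measures of paths as iterated integrals.\<close>

lemma nn_integral_eq_imp_measure_eq:
  assumes "sets M = sets L" "sets N = sets L"
    and "\<And>f. f \<in> borel_measurable L \<Longrightarrow> (\<integral>\<^sup>+x. f x \<partial>M) = (\<integral>\<^sup>+x. f x \<partial>N)"
  shows "M = N"
proof (rule measure_eqI)
  show "sets M = sets N" using assms by simp
  fix A assume "A \<in> sets M"
  then show "emeasure M A = emeasure N A"
    using assms(3)[of "indicator A"] assms(1,2) by simp
qed

lemma subprob_space_scale_measure:
  assumes "subprob_space M" "c \<le> 1"
  shows "subprob_space (scale_measure c M)"
proof -
  interpret subprob_space M by fact
  have "c * emeasure M (space M) \<le> 1 * 1"
    by (intro mult_mono assms(2) emeasure_space_le_1) auto
  then show ?thesis
    by (intro subprob_spaceI) (auto simp: space_scale_measure subprob_not_empty)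
qed

lemma fun_upd_PiM_measurable:
  assumes "I = insert i J"
  shows "(\<lambda>(y, z). z(i := y)) \<in> E i \<Otimes>\<^sub>M Pi\<^sub>M J E \<rightarrow>\<^sub>M Pi\<^sub>M I E"
  unfolding split_beta' using assms by (intro measurable_fun_upd[where J=J]) auto

text \<open>This is the kernel under the bind in \<open>forward_product\<close>
  (\<open>i = Suc p\<close>) and in \<open>backward_product\<close> (\<open>i = n\<close>), so it
  supplies the measurability of both recursions. It also serves for the final attachment of the
  starting point.\<close>

lemma kernel_extend:
  assumes I: "I = insert i J" and L: "L \<in> E i \<rightarrow>\<^sub>M subprob_algebra (Pi\<^sub>M J E)"
  shows "(\<lambda>y. distr (L y) (Pi\<^sub>M I E) (\<lambda>z. z(i := y))) \<in> E i \<rightarrow>\<^sub>M subprob_algebra (Pi\<^sub>M I E)"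
  by (rule measurable_distr2[OF fun_upd_PiM_measurable[OF I] L])

text \<open>Turns one unfolding of either recursion into an iterated integral. Leaving \<mu> an
  arbitrary measure lets it be a transition, \<open>\<gamma> n\<close> or
  \<open>\<eta> n\<close>.\<close>

lemma nn_integral_bind_extend:
  assumes I: "I = insert i J" and L: "L \<in> E i \<rightarrow>\<^sub>M subprob_algebra (Pi\<^sub>M J E)"
    and \<mu>: "sets \<mu> = sets (E i)" and f: "f \<in> borel_measurable (Pi\<^sub>M I E)"
  shows "(\<integral>\<^sup>+w. f w \<partial>(\<mu> \<bind> (\<lambda>y. distr (L y) (Pi\<^sub>M I E) (\<lambda>z. z(i := y)))))
    = (\<integral>\<^sup>+y. \<integral>\<^sup>+z. f (z(i := y)) \<partial>L y \<partial>\<mu>)"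
proof -
  have "(\<integral>\<^sup>+w. f w \<partial>(\<mu> \<bind> (\<lambda>y. distr (L y) (Pi\<^sub>M I E) (\<lambda>z. z(i := y)))))
      = (\<integral>\<^sup>+y. \<integral>\<^sup>+w. f w \<partial>distr (L y) (Pi\<^sub>M I E) (\<lambda>z. z(i := y)) \<partial>\<mu>)"
    by (rule nn_integral_bind[OF f]) (simp add: measurable_cong_sets[OF \<mu> refl] kernel_extend[OF I L])
  also have "\<dots> = (\<integral>\<^sup>+y. \<integral>\<^sup>+z. f (z(i := y)) \<partial>L y \<partial>\<mu>)"
  proof (rule nn_integral_cong)
    fix y assume "y \<in> space \<mu>"
    then have y: "y \<in> space (E i)" using sets_eq_imp_space_eq[OF \<mu>] by simp
    have "(\<lambda>z. z(i := y)) \<in> L y \<rightarrow>\<^sub>M Pi\<^sub>M I E"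
      using measurable_Pair2[OF fun_upd_PiM_measurable[OF I, of E] y]
      by (simp add: measurable_cong_sets[OF sets_kernel[OF L y] refl])
    then show "(\<integral>\<^sup>+w. f w \<partial>distr (L y) (Pi\<^sub>M I E) (\<lambda>z. z(i := y))) = (\<integral>\<^sup>+z. f (z(i := y)) \<partial>L y)"
      using f by (subst nn_integral_distr) auto
  qed
  finally show ?thesis .
qed

section \<open>The Feynman-Kac model: trajectories, weights and total masses\<close>

locale feynman_kac =
  fixes E :: "nat \<Rightarrow> 'a measure"
    and P :: "'w measure"
    and X :: "nat \<Rightarrow> 'w \<Rightarrow> 'a"
    and \<eta>0 :: "'a measure"
    and M :: "nat \<Rightarrow> 'a \<Rightarrow> 'a measure"
    and G :: "nat \<Rightarrow> 'a \<Rightarrow> real"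
  assumes chain: "markov_chain P E X \<eta>0 M"
    and G_meas [measurable]: "\<And>n. G n \<in> borel_measurable (E n)"
    and G_range: "\<And>n. G n \<in> space (E n) \<rightarrow> {0<..1}"
begin

lemma prob_P: "prob_space P"
  using chain by (simp add: markov_chain_def)

sublocale prob_space P by (rule prob_P)

lemma X_measurable [measurable]: "X n \<in> P \<rightarrow>\<^sub>M E n"
  using chain by (simp add: markov_chain_def)

lemma M_prob: "M (Suc n) \<in> E n \<rightarrow>\<^sub>M prob_algebra (E (Suc n))"
  using chain by (simp add: markov_chain_def)

lemma M_measurable [measurable]: "M (Suc n) \<in> E n \<rightarrow>\<^sub>M subprob_algebra (E (Suc n))"
  by (rule measurable_prob_algebraD[OF M_prob])

lemma sets_M: "x \<in> space (E n) \<Longrightarrow> sets (M (Suc n) x) = sets (E (Suc n))"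
  by (rule sets_kernel[OF M_measurable])

lemma prob_M: "x \<in> space (E n) \<Longrightarrow> prob_space (M (Suc n) x)"
  using measurable_space[OF M_prob] by (simp add: space_prob_algebra)

lemma space_E_nonempty: "space (E n) \<noteq> {}"
  using measurable_space[OF X_measurable] not_empty by blast

lemma X_in_space: "\<omega> \<in> space P \<Longrightarrow> X n \<omega> \<in> space (E n)"
  by (rule measurable_space[OF X_measurable])

lemma G_pos: "x \<in> space (E n) \<Longrightarrow> 0 < G n x" and G_le_1: "x \<in> space (E n) \<Longrightarrow> G n x \<le> 1"
  using G_range by (auto simp: Pi_iff)

abbreviation traj :: "nat \<Rightarrow> nat \<Rightarrow> 'w \<Rightarrow> nat \<Rightarrow> 'a" where
  "traj p n \<omega> \<equiv> \<lambda>i\<in>{p..n}. X i \<omega>"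

abbreviation W :: "nat \<Rightarrow> 'w \<Rightarrow> real" where
  "W n \<equiv> FK_weight X G n"

abbreviation \<gamma> :: "nat \<Rightarrow> 'a measure" where
  "\<gamma> n \<equiv> FK_gamma P E X G n"

abbreviation \<eta> :: "nat \<Rightarrow> 'a measure" where
  "\<eta> n \<equiv> FK_eta P E X G n"

abbreviation Q :: "nat \<Rightarrow> 'a \<Rightarrow> 'a measure" where
  "Q n \<equiv> FK_kernel G M n"

lemma traj_measurable [measurable]: "traj p n \<in> P \<rightarrow>\<^sub>M Pi\<^sub>M {p..n} E"
  by (rule measurable_restrict) (rule X_measurable)

lemma W_measurable [measurable]: "W n \<in> borel_measurable P"
  by (rule FK_weight_measurable[OF X_measurable G_meas])

lemma W_nonneg: "\<omega> \<in> space P \<Longrightarrow> 0 \<le> W n \<omega>"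
  by (rule FK_weight_nonneg[OF X_measurable G_range])

text \<open>The weight at time \<open>n\<close> stops at index \<open>n - 1\<close>, so the new
  factor is evaluated at the current state \<open>X n\<close>; it is the factor that turns
  \<open>M (Suc n)\<close> into \<open>Q (Suc n)\<close>.\<close>

lemma W_Suc: "\<omega> \<in> space P \<Longrightarrow> ennreal (W (Suc n) \<omega>) = ennreal (W n \<omega>) * ennreal (G n (X n \<omega>))"
  unfolding FK_weight_def using G_pos[OF X_in_space]
  by (simp add: ennreal_mult'' less_imp_le)

lemma W_pos: "\<omega> \<in> space P \<Longrightarrow> 0 < W n \<omega>"
  unfolding FK_weight_def by (intro prod_pos) (auto intro: G_pos X_in_space)

lemma W_le_1: "\<omega> \<in> space P \<Longrightarrow> W n \<omega> \<le> 1"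
  unfolding FK_weight_def
  by (intro prod_le_1) (auto intro: G_le_1 less_imp_le[OF G_pos] X_in_space)

lemma traj_Suc: "r \<le> Suc n \<Longrightarrow> traj r (Suc n) \<omega> = (traj r n \<omega>)(Suc n := X (Suc n) \<omega>)"
  by (auto simp: fun_eq_iff restrict_def)

lemma sets_gamma [measurable_cong, simp]: "sets (\<gamma> n) = sets (E n)"
  and space_gamma [simp]: "space (\<gamma> n) = space (E n)"
  by (auto simp: FK_gamma_def)

lemma sets_eta [measurable_cong, simp]: "sets (\<eta> n) = sets (E n)"
  and space_eta [simp]: "space (\<eta> n) = space (E n)"
  by (auto simp: FK_eta_def space_scale_measure)

lemma nn_integral_gamma:
  assumes [measurable]: "f \<in> borel_measurable (E n)"
  shows "(\<integral>\<^sup>+x. f x \<partial>\<gamma> n) = (\<integral>\<^sup>+\<omega>. ennreal (W n \<omega>) * f (X n \<omega>) \<partial>P)"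
  unfolding FK_gamma_def by (subst nn_integral_distr) (auto simp: nn_integral_density)

lemma emeasure_gamma_space: "emeasure (\<gamma> n) (space (E n)) = (\<integral>\<^sup>+\<omega>. ennreal (W n \<omega>) \<partial>P)"
  using nn_integral_gamma[of "\<lambda>_. 1" n] by simp

lemma gamma_total_le_1: "emeasure (\<gamma> n) (space (E n)) \<le> 1"
proof -
  have "(\<integral>\<^sup>+\<omega>. ennreal (W n \<omega>) \<partial>P) \<le> (\<integral>\<^sup>+\<omega>. 1 \<partial>P)"
    by (intro nn_integral_mono) (auto simp: W_le_1)
  then show ?thesis by (simp add: emeasure_gamma_space emeasure_space_1)
qed

text \<open>A strictly positive weight cannot integrate to zero against a probability. Together with
  the bound by 1 this makes the normalisation defining \<open>\<eta> n\<close> legitimate.\<close>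

lemma gamma_total_nonzero: "emeasure (\<gamma> n) (space (E n)) \<noteq> 0"
proof
  assume "emeasure (\<gamma> n) (space (E n)) = 0"
  then have "AE \<omega> in P. ennreal (W n \<omega>) = 0"
    unfolding emeasure_gamma_space by (subst (asm) nn_integral_0_iff_AE) auto
  moreover have "AE \<omega> in P. ennreal (W n \<omega>) \<noteq> 0"
    by (rule AE_I2) (simp add: W_pos ennreal_eq_0_iff not_le)
  ultimately have "AE \<omega> in P. False" by eventually_elim simp
  then show False by simp
qed

lemma subprob_gamma: "subprob_space (\<gamma> n)"
  by (rule subprob_spaceI) (auto simp: gamma_total_le_1 space_E_nonempty)

lemma prob_eta: "prob_space (\<eta> n)"
proof (rule prob_spaceI)
  have "emeasure (\<gamma> n) (space (E n)) \<noteq> \<top>"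
    using gamma_total_le_1[of n] by (auto simp: top_unique)
  then show "emeasure (\<eta> n) (space (\<eta> n)) = 1"
    unfolding space_eta
    using gamma_total_nonzero by (simp add: FK_eta_def ennreal_divide_times ennreal_divide_self less_top)
qed

lemma nn_integral_eta:
  assumes "f \<in> borel_measurable (E n)"
  shows "(\<integral>\<^sup>+x. f x \<partial>\<eta> n) = 1 / emeasure (\<gamma> n) (space (E n)) * (\<integral>\<^sup>+x. f x \<partial>\<gamma> n)"
  unfolding FK_eta_def using assms by (intro nn_integral_scale_measure) (simp cong: measurable_cong_sets)

section \<open>The Markov property\<close>

text \<open>The indicator of \<open>B\<close> along the trajectory is measurable for the history, so
  the indicator of \<open>A\<close> may be replaced by its conditional expectation, which the chain
  identifies with the transition probability.\<close>

lemma markov_rectangle: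
  assumes A: "A \<in> sets (E (Suc n))" and B: "B \<in> sets (Pi\<^sub>M {0..n} E)"
  shows "(\<integral>\<^sup>+\<omega>. indicator B (traj 0 n \<omega>) * indicator A (X (Suc n) \<omega>) \<partial>P)
    = (\<integral>\<^sup>+\<omega>. indicator B (traj 0 n \<omega>) * emeasure (M (Suc n) (X n \<omega>)) A \<partial>P)"
proof -
  let ?F = "history P E X n"
  let ?b = "\<lambda>\<omega>. indicator B (traj 0 n \<omega>) :: real"
  let ?a = "\<lambda>\<omega>. indicator A (X (Suc n) \<omega>) :: real"
  note [measurable] = A B
  have traj: "traj 0 n \<in> space P \<rightarrow> space (Pi\<^sub>M {0..n} E)"
    using measurable_space[OF traj_measurable] by blast
  \<comment> \<open>The history consists of preimages under the measurable trajectory map.\<close>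
  have sub: "subalgebra P ?F"
    unfolding subalgebra_def history_def sets_vimage_algebra2[OF traj]
    using measurable_sets[OF traj_measurable] by auto
  interpret finite_measure_subalgebra P ?F
    by unfold_locales (rule sub)
  have b: "?b \<in> borel_measurable ?F"
    unfolding history_def by (rule measurable_compose[OF measurable_vimage_algebra1[OF traj]]) simp
  have [measurable]: "(\<lambda>\<omega>. measure (M (Suc n) (X n \<omega>)) A) \<in> borel_measurable P"
    by (rule measurable_compose[OF X_measurable], rule measure_measurable_subprob_algebra2[where N="E (Suc n)", OF _ M_measurable])
       measurable
  have ce: "AE \<omega> in P. real_cond_exp P ?F ?a \<omega> = measure (M (Suc n) (X n \<omega>)) A"
    using chain A by (auto simp: markov_chain_def)
  \<comment> \<open>Both products are bounded by 1, hence integrable; this allows the use of real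
    conditional expectation and the return to nonnegative integrals.\<close>
  have int: "integrable P (\<lambda>\<omega>. ?b \<omega> * ?a \<omega>)"
    by (rule integrable_const_bound[where B=1]) (auto simp: indicator_def)
  have bound: "measure (M (Suc n) (X n \<omega>)) A \<le> 1" if "\<omega> \<in> space P" for \<omega>
    by (rule prob_space.prob_le_1[OF prob_M[OF X_in_space[OF that]]])
  have int': "integrable P (\<lambda>\<omega>. ?b \<omega> * measure (M (Suc n) (X n \<omega>)) A)"
    by (rule integrable_const_bound[where B=1]) (auto simp: indicator_def bound)
  have "(\<integral>\<omega>. ?b \<omega> * ?a \<omega> \<partial>P) = (\<integral>\<omega>. ?b \<omega> * real_cond_exp P ?F ?a \<omega> \<partial>P)"
    by (rule real_cond_exp_intg(2)[symmetric, OF int b]) measurable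
  also have "\<dots> = (\<integral>\<omega>. ?b \<omega> * measure (M (Suc n) (X n \<omega>)) A \<partial>P)"
    using ce by (intro integral_cong_AE) auto
  finally have eq: "(\<integral>\<omega>. ?b \<omega> * ?a \<omega> \<partial>P) = (\<integral>\<omega>. ?b \<omega> * measure (M (Suc n) (X n \<omega>)) A \<partial>P)" .
  have "(\<integral>\<^sup>+\<omega>. indicator B (traj 0 n \<omega>) * indicator A (X (Suc n) \<omega>) \<partial>P)
      = (\<integral>\<^sup>+\<omega>. ennreal (?b \<omega> * ?a \<omega>) \<partial>P)"
    by (intro nn_integral_cong) (auto simp: indicator_def)
  also have "\<dots> = ennreal (\<integral>\<omega>. ?b \<omega> * ?a \<omega> \<partial>P)"
    by (rule nn_integral_eq_integral[OF int]) simp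
  also have "\<dots> = (\<integral>\<^sup>+\<omega>. ennreal (?b \<omega> * measure (M (Suc n) (X n \<omega>)) A) \<partial>P)"
    unfolding eq by (rule nn_integral_eq_integral[OF int', symmetric]) simp
  also have "\<dots> = (\<integral>\<^sup>+\<omega>. indicator B (traj 0 n \<omega>) * emeasure (M (Suc n) (X n \<omega>)) A \<partial>P)"
    using finite_measure.emeasure_eq_measure[OF prob_space.finite_measure[OF prob_M[OF X_in_space]]]
    by (intro nn_integral_cong) (auto simp: indicator_def)
  finally show ?thesis .
qed

text \<open>Both sides are integrals over pairs of a history and a next state, against the joint law
  \<mu> and against the mixture \<open>P \<bind> ?K\<close>. These measures agree on rectangles, an
  intersection-stable generator, hence everywhere.\<close>

lemma markov_step:
  assumes f [measurable]: "case_prod f \<in> borel_measurable (Pi\<^sub>M {0..n} E \<Otimes>\<^sub>M E (Suc n))"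
  shows "(\<integral>\<^sup>+\<omega>. f (traj 0 n \<omega>) (X (Suc n) \<omega>) \<partial>P)
    = (\<integral>\<^sup>+\<omega>. \<integral>\<^sup>+y. f (traj 0 n \<omega>) y \<partial>M (Suc n) (X n \<omega>) \<partial>P)"
proof -
  let ?H = "Pi\<^sub>M {0..n} E" and ?N = "Pi\<^sub>M {0..n} E \<Otimes>\<^sub>M E (Suc n)"
  let ?K = "\<lambda>\<omega>. distr (M (Suc n) (X n \<omega>)) ?N (\<lambda>y. (traj 0 n \<omega>, y))"
  define \<mu> where "\<mu> = distr P ?N (\<lambda>\<omega>. (traj 0 n \<omega>, X (Suc n) \<omega>))"
  have K [measurable]: "?K \<in> P \<rightarrow>\<^sub>M subprob_algebra ?N"
    by (rule measurable_distr2[where M = "E (Suc n)"]) measurable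
  have K_in: "(\<lambda>y. (traj 0 n \<omega>, y)) \<in> M (Suc n) (X n \<omega>) \<rightarrow>\<^sub>M ?N" if "\<omega> \<in> space P" for \<omega>
    using measurable_space[OF traj_measurable that]
    by (subst measurable_cong_sets[OF sets_M[OF X_in_space[OF that]] refl]) (rule measurable_Pair1')
  have "\<mu> = P \<bind> ?K"
  proof (rule measure_eqI_generator_eq)
    let ?G = "{a \<times> b | a b. a \<in> sets ?H \<and> b \<in> sets (E (Suc n))}"
    show "Int_stable ?G" by (rule Int_stable_pair_measure_generator)
    show "?G \<subseteq> Pow (space ?H \<times> space (E (Suc n)))" by (rule pair_measure_closed)
    show "sets \<mu> = sigma_sets (space ?H \<times> space (E (Suc n))) ?G"
      by (simp add: \<mu>_def sets_pair_measure)
    show "sets (P \<bind> ?K) = sigma_sets (space ?H \<times> space (E (Suc n))) ?G"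
      by (simp add: sets_bind_measurable[OF K not_empty] sets_pair_measure)
    \<comment> \<open>The whole space is itself a rectangle of finite mass, so a constant sequence
      serves as the exhaustion.\<close>
    show "range (\<lambda>_::nat. space ?H \<times> space (E (Suc n))) \<subseteq> ?G" by auto
    show "(\<Union>i::nat. space ?H \<times> space (E (Suc n))) = space ?H \<times> space (E (Suc n))" by simp
    show "emeasure \<mu> (space ?H \<times> space (E (Suc n))) \<noteq> \<infinity>"
      using prob_space.emeasure_space_1[OF prob_space_distr, of "\<lambda>\<omega>. (traj 0 n \<omega>, X (Suc n) \<omega>)" ?N]
      by (simp add: \<mu>_def space_pair_measure)
    fix C assume "C \<in> ?G"
    then obtain B A where C: "C = B \<times> A" and [measurable]: "B \<in> sets ?H" "A \<in> sets (E (Suc n))"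
      by auto
    have "emeasure \<mu> C = (\<integral>\<^sup>+z. indicator C z \<partial>\<mu>)"
      by (subst nn_integral_indicator) (auto simp: C \<mu>_def)
    also have "\<dots> = (\<integral>\<^sup>+\<omega>. indicator B (traj 0 n \<omega>) * indicator A (X (Suc n) \<omega>) \<partial>P)"
      unfolding \<mu>_def by (subst nn_integral_distr) (auto simp: C indicator_times)
    also have "\<dots> = (\<integral>\<^sup>+\<omega>. indicator B (traj 0 n \<omega>) * emeasure (M (Suc n) (X n \<omega>)) A \<partial>P)"
      by (rule markov_rectangle) auto
    also have "\<dots> = (\<integral>\<^sup>+\<omega>. emeasure (?K \<omega>) C \<partial>P)"
    proof (rule nn_integral_cong)
      fix \<omega> assume \<omega>: "\<omega> \<in> space P"
      \<comment> \<open>Under \<open>?K \<omega>\<close> the history is frozen, so the section of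
        the rectangle is either \<open>A\<close> or empty.\<close>
      have "(\<lambda>y. (traj 0 n \<omega>, y)) -` C \<inter> space (M (Suc n) (X n \<omega>))
          = (if traj 0 n \<omega> \<in> B then A else {})"
        using sets.sets_into_space[of A "E (Suc n)"] sets_eq_imp_space_eq[OF sets_M[OF X_in_space[OF \<omega>]]]
        by (auto simp: C)
      then show "indicator B (traj 0 n \<omega>) * emeasure (M (Suc n) (X n \<omega>)) A = emeasure (?K \<omega>) C"
        by (subst emeasure_distr[OF K_in[OF \<omega>]]) (auto simp: C)
    qed
    also have "\<dots> = emeasure (P \<bind> ?K) C"
      by (rule emeasure_bind[OF not_empty K, symmetric]) (simp add: C)
    finally show "emeasure \<mu> C = emeasure (P \<bind> ?K) C" .
  qed
  moreover have "(\<integral>\<^sup>+z. case_prod f z \<partial>\<mu>) = (\<integral>\<^sup>+\<omega>. f (traj 0 n \<omega>) (X (Suc n) \<omega>) \<partial>P)"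
    unfolding \<mu>_def by (subst nn_integral_distr) auto
  moreover have "(\<integral>\<^sup>+z. case_prod f z \<partial>(P \<bind> ?K))
      = (\<integral>\<^sup>+\<omega>. \<integral>\<^sup>+y. f (traj 0 n \<omega>) y \<partial>M (Suc n) (X n \<omega>) \<partial>P)"
    unfolding nn_integral_bind[OF f K]
    by (intro nn_integral_cong) (subst nn_integral_distr[OF K_in], auto)
  ultimately show ?thesis by simp
qed

section \<open>Weighted transitions and one weighted step of the chain\<close>

text \<open>The bound \<open>G n x \<le> 1\<close> makes \<open>Q (Suc n) x\<close> a
  subprobability, so the results on \<open>subprob_algebra\<close> apply to it.\<close>

lemma Q_measurable [measurable]: "Q (Suc n) \<in> E n \<rightarrow>\<^sub>M subprob_algebra (E (Suc n))"
proof (rule measurable_subprob_algebra)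
  fix x assume x: "x \<in> space (E n)"
  show "subprob_space (Q (Suc n) x)"
    unfolding FK_kernel_def using G_le_1[OF x]
    by (intro subprob_space_scale_measure prob_space_imp_subprob_space prob_M x) auto
  show "sets (Q (Suc n) x) = sets (E (Suc n))"
    by (simp add: FK_kernel_def sets_M x)
next
  fix A assume [measurable]: "A \<in> sets (E (Suc n))"
  have "(\<lambda>x. emeasure (M (Suc n) x) A) \<in> borel_measurable (E n)"
    by (rule measurable_compose[OF M_measurable]) (rule measurable_emeasure_subprob_algebra, fact)
  then show "(\<lambda>x. emeasure (Q (Suc n) x) A) \<in> borel_measurable (E n)"
    by (simp add: FK_kernel_def)
qed

lemma nn_integral_Q:
  assumes x: "x \<in> space (E n)" and f: "f \<in> borel_measurable (E (Suc n))"
  shows "(\<integral>\<^sup>+y. f y \<partial>Q (Suc n) x) = ennreal (G n x) * (\<integral>\<^sup>+y. f y \<partial>M (Suc n) x)"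
  unfolding FK_kernel_def
  by (subst nn_integral_scale_measure) (simp_all add: f measurable_cong_sets[OF sets_M[OF x] refl])

text \<open>\<open>W (Suc n)\<close> involves only \<open>X 0\<close> to \<open>X n\<close>, so the
  Markov property applies to its product with \<open>f\<close>. Its last factor
  \<open>G n (X n \<omega>)\<close> is then absorbed into \<open>Q (Suc n)\<close>.\<close>

lemma weighted_step:
  assumes r: "r \<le> n" and f [measurable]: "case_prod f \<in> borel_measurable (Pi\<^sub>M {r..n} E \<Otimes>\<^sub>M E (Suc n))"
  shows "(\<integral>\<^sup>+\<omega>. ennreal (W (Suc n) \<omega>) * f (traj r n \<omega>) (X (Suc n) \<omega>) \<partial>P)
    = (\<integral>\<^sup>+\<omega>. ennreal (W n \<omega>) * (\<integral>\<^sup>+y. f (traj r n \<omega>) y \<partial>Q (Suc n) (X n \<omega>)) \<partial>P)"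
proof -
  \<comment> \<open>The weight as a function of the history; the product ends at
    \<open>q = n\<close>, so every coordinate used lies in \<open>{0..n}\<close>.\<close>
  define w where "w h = ennreal (\<Prod>q<Suc n. G q (h q))" for h :: "nat \<Rightarrow> 'a"
  have [measurable]: "w \<in> borel_measurable (Pi\<^sub>M {0..n} E)"
    unfolding w_def
    by (intro measurable_compose[OF _ measurable_ennreal] borel_measurable_prod
        measurable_compose[where f="\<lambda>h. h q" for q, OF _ G_meas]) (auto intro: measurable_component_singleton)
  \<comment> \<open>The Markov property concerns histories from time 0, so a function of the path
    from time \<open>r\<close> on is precomposed with restriction.\<close>
  have [measurable]: "(\<lambda>h. restrict h {r..n}) \<in> Pi\<^sub>M {0..n} E \<rightarrow>\<^sub>M Pi\<^sub>M {r..n} E"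
    by (rule measurable_restrict_subset) auto
  have restr: "restrict (traj 0 n \<omega>) {r..n} = traj r n \<omega>" for \<omega>
    by (auto simp: fun_eq_iff restrict_def)
  have w: "w (traj 0 n \<omega>) = ennreal (W (Suc n) \<omega>)" for \<omega>
    by (auto simp: w_def FK_weight_def intro!: arg_cong[where f=ennreal] prod.cong)
  have "(\<integral>\<^sup>+\<omega>. ennreal (W (Suc n) \<omega>) * f (traj r n \<omega>) (X (Suc n) \<omega>) \<partial>P)
      = (\<integral>\<^sup>+\<omega>. \<integral>\<^sup>+y. ennreal (W (Suc n) \<omega>) * f (traj r n \<omega>) y \<partial>M (Suc n) (X n \<omega>) \<partial>P)"
    using markov_step[of "\<lambda>h y. w h * f (restrict h {r..n}) y" n] unfolding restr w by measurable
  also have "\<dots> = (\<integral>\<^sup>+\<omega>. ennreal (W n \<omega>) * (\<integral>\<^sup>+y. f (traj r n \<omega>) y \<partial>Q (Suc n) (X n \<omega>)) \<partial>P)"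
  proof (rule nn_integral_cong)
    fix \<omega> assume \<omega>: "\<omega> \<in> space P"
    have fm: "f (traj r n \<omega>) \<in> borel_measurable (E (Suc n))"
      using measurable_Pair2[OF f measurable_space[OF traj_measurable \<omega>]] by simp
    then have "(\<integral>\<^sup>+y. ennreal (W (Suc n) \<omega>) * f (traj r n \<omega>) y \<partial>M (Suc n) (X n \<omega>))
       = ennreal (W (Suc n) \<omega>) * (\<integral>\<^sup>+y. f (traj r n \<omega>) y \<partial>M (Suc n) (X n \<omega>))"
      by (intro nn_integral_cmult) (simp add: measurable_cong_sets[OF sets_M[OF X_in_space[OF \<omega>]] refl])
    then show "(\<integral>\<^sup>+y. ennreal (W (Suc n) \<omega>) * f (traj r n \<omega>) y \<partial>M (Suc n) (X n \<omega>))
       = ennreal (W n \<omega>) * (\<integral>\<^sup>+y. f (traj r n \<omega>) y \<partial>Q (Suc n) (X n \<omega>))"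
      by (simp add: nn_integral_Q[OF X_in_space[OF \<omega>] fm] W_Suc[OF \<omega>] mult.assoc)
  qed
  finally show ?thesis .
qed

section \<open>The forward product\<close>

abbreviation F :: "nat \<Rightarrow> nat \<Rightarrow> 'a \<Rightarrow> (nat \<Rightarrow> 'a) measure" where
  "F p n \<equiv> FK_forward E G M p n"

lemma F_same: "F n n x = return (Pi\<^sub>M {} E) (\<lambda>_. undefined)"
  by (simp add: FK_forward_def forward_product.simps[of _ _ n n])

lemma F_less:
  "p < n \<Longrightarrow> F p n x = Q (Suc p) x \<bind>
     (\<lambda>y. distr (F (Suc p) n y) (Pi\<^sub>M {p<..n} E) (\<lambda>z. z(Suc p := y)))"
  by (simp add: FK_forward_def forward_product.simps[of _ _ p n])

lemma insert_greaterThanAtMost: "p < n \<Longrightarrow> {p<..n} = insert (Suc p) {Suc p<..n}"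
  for p n :: nat
  by auto

text \<open>Downward induction on \<open>p\<close>, because the recursion peels off the first
  transition.\<close>

lemma F_measurable: "p \<le> n \<Longrightarrow> F p n \<in> E p \<rightarrow>\<^sub>M subprob_algebra (Pi\<^sub>M {p<..n} E)"
proof (induction p rule: inc_induct)
  case base
  have "return (Pi\<^sub>M {} E) (\<lambda>_. undefined) \<in> space (subprob_algebra (Pi\<^sub>M {} E))"
    by (rule measurable_space[OF return_measurable]) (simp add: space_PiM)
  moreover have "F n n = (\<lambda>_. return (Pi\<^sub>M {} E) (\<lambda>_. undefined))"
    by (rule ext) (rule F_same)
  ultimately show ?case by simp
next
  case (step p)
  show ?case
    unfolding F_less[OF step.hyps(2), abs_def]
    by (rule measurable_bind2[OF Q_measurable kernel_extend[OF insert_greaterThanAtMost[OF step.hyps(2)] step.IH]])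
qed

lemma nn_integral_F_less:
  assumes "p < n" "x \<in> space (E p)" "f \<in> borel_measurable (Pi\<^sub>M {p<..n} E)"
  shows "(\<integral>\<^sup>+z. f z \<partial>F p n x) = (\<integral>\<^sup>+y. \<integral>\<^sup>+z. f (z(Suc p := y)) \<partial>F (Suc p) n y \<partial>Q (Suc p) x)"
  unfolding F_less[OF assms(1)]
  using assms F_measurable[of "Suc p" n]
  by (intro nn_integral_bind_extend insert_greaterThanAtMost sets_kernel[OF Q_measurable]) auto

lemma merge_measurable:
  assumes "r \<le> p" "p \<le> n"
  shows "merge {r..p} {p<..n} \<in> Pi\<^sub>M {r..p} E \<Otimes>\<^sub>M Pi\<^sub>M {p<..n} E \<rightarrow>\<^sub>M Pi\<^sub>M {r..n} E"
proof -
  have "{r..p} \<union> {p<..n} = {r..n}" using assms by auto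
  then show ?thesis using measurable_merge[of "{r..p}" "{p<..n}" E] by simp
qed

text \<open>Interpolates between chain and kernels: coordinates \<open>r\<close> to \<open>p\<close>
  come from the trajectory, the later ones from \<open>F p n\<close>. With \<open>r\<close> fixed
  and \<open>p\<close> descending from \<open>n\<close>, each step of the induction replaces one
  kernel transition by a move of the chain.\<close>

lemma nn_integral_forward:
  assumes "r \<le> p" "p \<le> n" and f: "f \<in> borel_measurable (Pi\<^sub>M {r..n} E)"
  shows "(\<integral>\<^sup>+\<omega>. ennreal (W p \<omega>) *
      (\<integral>\<^sup>+z. f (merge {r..p} {p<..n} (traj r p \<omega>, z)) \<partial>F p n (X p \<omega>)) \<partial>P)
    = (\<integral>\<^sup>+\<omega>. ennreal (W n \<omega>) * f (traj r n \<omega>) \<partial>P)"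
  using assms(2,1)
proof (induction p rule: inc_induct)
  case base
  \<comment> \<open>Off \<open>{r..n}\<close> both the merge and the restricted trajectory are
    \<open>undefined\<close>, so an empty tail changes nothing.\<close>
  have m: "merge {r..n} {n<..n} (traj r n \<omega>, \<lambda>_. undefined) = traj r n \<omega>" for \<omega>
    by (auto simp: fun_eq_iff merge_def)
  have "(\<integral>\<^sup>+z. f (merge {r..n} {n<..n} (traj r n \<omega>, z)) \<partial>F n n (X n \<omega>)) = f (traj r n \<omega>)"
    if "\<omega> \<in> space P" for \<omega>
  proof -
    have "(\<lambda>z. f (merge {r..n} {n<..n} (traj r n \<omega>, z))) \<in> borel_measurable (Pi\<^sub>M {} E)"
      using measurable_compose[OF measurable_Pair2[OF merge_measurable[of r n n]
          measurable_space[OF traj_measurable that]] f] base by simp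
    then show ?thesis
      unfolding F_same by (subst nn_integral_return) (auto simp: space_PiM m[simplified])
  qed
  then show ?case by (intro nn_integral_cong) (simp only:)
next
  case (step p)
  let ?m = "\<lambda>q h z. merge {r..q} {q<..n} (h, z)"
  \<comment> \<open>All times after \<open>Suc p\<close> are integrated out, which leaves a function
    of the path up to \<open>p\<close> and the next state, the shape that
    \<open>weighted_step\<close> accepts.\<close>
  define \<phi> where "\<phi> h y = (\<integral>\<^sup>+z. f (?m (Suc p) (h(Suc p := y)) z) \<partial>F (Suc p) n y)" for h y
  \<comment> \<open>Coordinate \<open>Suc p\<close> moves from the tail to the head without changing
    the merged path.\<close>
  have upd: "?m p h (z(Suc p := y)) = ?m (Suc p) (h(Suc p := y)) z" for h y z
    using step.hyps step.prems by (auto simp: fun_eq_iff merge_def)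
  have rp: "r \<le> p" and pn: "p < n" using step by auto
  have \<phi>: "case_prod \<phi> \<in> borel_measurable (Pi\<^sub>M {r..p} E \<Otimes>\<^sub>M E (Suc p))"
  proof -
    have [measurable]: "(\<lambda>hy. F (Suc p) n (snd hy)) \<in> Pi\<^sub>M {r..p} E \<Otimes>\<^sub>M E (Suc p) \<rightarrow>\<^sub>M
        subprob_algebra (Pi\<^sub>M {Suc p<..n} E)"
      using pn by (intro measurable_compose[OF measurable_snd F_measurable]) auto
    have "(\<lambda>u. (fst (fst u))(Suc p := snd (fst u))) \<in>
        (Pi\<^sub>M {r..p} E \<Otimes>\<^sub>M E (Suc p)) \<Otimes>\<^sub>M Pi\<^sub>M {Suc p<..n} E \<rightarrow>\<^sub>M Pi\<^sub>M {r..Suc p} E"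
      using rp by (intro measurable_fun_upd[where J="{r..p}"]) auto
    then have "(\<lambda>u. ?m (Suc p) ((fst (fst u))(Suc p := snd (fst u))) (snd u)) \<in>
        (Pi\<^sub>M {r..p} E \<Otimes>\<^sub>M E (Suc p)) \<Otimes>\<^sub>M Pi\<^sub>M {Suc p<..n} E \<rightarrow>\<^sub>M Pi\<^sub>M {r..n} E"
      using rp pn by (intro measurable_compose[OF _ merge_measurable] measurable_Pair) auto
    then show ?thesis
      unfolding \<phi>_def split_beta'
      by (intro nn_integral_measurable_subprob_algebra2[where N="Pi\<^sub>M {Suc p<..n} E"])
         (auto simp: split_beta' intro: measurable_compose[OF _ f])
  qed
  have "(\<integral>\<^sup>+\<omega>. ennreal (W p \<omega>) * (\<integral>\<^sup>+z. f (?m p (traj r p \<omega>) z) \<partial>F p n (X p \<omega>)) \<partial>P)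
      = (\<integral>\<^sup>+\<omega>. ennreal (W p \<omega>) * (\<integral>\<^sup>+y. \<phi> (traj r p \<omega>) y \<partial>Q (Suc p) (X p \<omega>)) \<partial>P)"
  proof (rule nn_integral_cong)
    fix \<omega> assume \<omega>: "\<omega> \<in> space P"
    have "(\<lambda>z. f (?m p (traj r p \<omega>) z)) \<in> borel_measurable (Pi\<^sub>M {p<..n} E)"
      using rp pn by (intro measurable_compose[OF measurable_Pair2[OF merge_measurable
          measurable_space[OF traj_measurable \<omega>]] f]) auto
    from nn_integral_F_less[OF pn X_in_space[OF \<omega>] this]
    show "ennreal (W p \<omega>) * (\<integral>\<^sup>+z. f (?m p (traj r p \<omega>) z) \<partial>F p n (X p \<omega>))
      = ennreal (W p \<omega>) * (\<integral>\<^sup>+y. \<phi> (traj r p \<omega>) y \<partial>Q (Suc p) (X p \<omega>))"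
      by (simp only: upd \<phi>_def)
  qed
  also have "\<dots> = (\<integral>\<^sup>+\<omega>. ennreal (W (Suc p) \<omega>) * \<phi> (traj r p \<omega>) (X (Suc p) \<omega>) \<partial>P)"
    by (rule weighted_step[OF rp \<phi>, symmetric])
  \<comment> \<open>The head extended by \<open>X (Suc p) \<omega>\<close> is
    \<open>traj r (Suc p) \<omega>\<close>, so the induction hypothesis applies.\<close>
  also have "\<dots> = (\<integral>\<^sup>+\<omega>. ennreal (W n \<omega>) * f (traj r n \<omega>) \<partial>P)"
    unfolding \<phi>_def using step.IH rp by (simp only: traj_Suc le_SucI)
  finally show ?case .
qed

end

section \<open>Backward kernels\<close>

locale feynman_kac_density = feynman_kac E P X \<eta>0 M G
  for E :: "nat \<Rightarrow> 'a measure"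
    and P :: "'w measure"
    and X :: "nat \<Rightarrow> 'w \<Rightarrow> 'a"
    and \<eta>0 :: "'a measure"
    and M :: "nat \<Rightarrow> 'a \<Rightarrow> 'a measure"
    and G :: "nat \<Rightarrow> 'a \<Rightarrow> real" +
  fixes H :: "nat \<Rightarrow> 'a \<Rightarrow> 'a \<Rightarrow> real"
    and lam :: "nat \<Rightarrow> 'a measure"
    and \<nu> :: "nat \<Rightarrow> 'a \<Rightarrow> 'a measure"
  assumes lam_sigma_finite: "\<And>n. sigma_finite_measure (lam (Suc n))"
    and lam_sets: "\<And>n. sets (lam (Suc n)) = sets (E (Suc n))"
    and H_meas: "\<And>n. (\<lambda>(x, y). H (Suc n) x y) \<in> borel_measurable (E n \<Otimes>\<^sub>M E (Suc n))"
    and H_pos: "\<And>n x y. x \<in> space (E n) \<Longrightarrow> y \<in> space (E (Suc n)) \<Longrightarrow> 0 < H (Suc n) x y"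
    and M_density: "\<And>n x. x \<in> space (E n) \<Longrightarrow>
          M (Suc n) x = density (lam (Suc n)) (\<lambda>y. ennreal (H (Suc n) x y))"
    and \<nu>_prob: "\<And>n. \<nu> n \<in> E (Suc n) \<rightarrow>\<^sub>M prob_algebra (E n)"
begin

abbreviation K :: "nat \<Rightarrow> 'a \<Rightarrow> 'a measure" where
  "K n \<equiv> backward_kernel G H (\<nu> n) n (\<eta> n)"

abbreviation B :: "nat \<Rightarrow> nat \<Rightarrow> 'a \<Rightarrow> (nat \<Rightarrow> 'a) measure" where
  "B n r \<equiv> FK_backward P E X G H \<nu> n r"

text \<open>The density of \<open>Q (Suc n) y\<close> with respect to \<open>lam (Suc n)\<close>.
  The earlier state \<open>y\<close> is the first argument, as in \<open>H\<close>.\<close>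

definition h :: "nat \<Rightarrow> 'a \<Rightarrow> 'a \<Rightarrow> ennreal" where
  "h n y x = ennreal (G n y * H (Suc n) y x)"

text \<open>The normalising denominator of the backward kernel at \<open>x\<close>, kept in
  \<open>ennreal\<close> because it may be infinite.\<close>

definition D :: "nat \<Rightarrow> 'a \<Rightarrow> ennreal" where
  "D n x = (\<integral>\<^sup>+y. h n y x \<partial>\<eta> n)"

lemma h_measurable [measurable]: "(\<lambda>(y, x). h n y x) \<in> borel_measurable (E n \<Otimes>\<^sub>M E (Suc n))"
proof -
  have "(\<lambda>u. H (Suc n) (fst u) (snd u)) \<in> borel_measurable (E n \<Otimes>\<^sub>M E (Suc n))"
    using H_meas by (simp add: split_beta')
  then show ?thesis unfolding h_def split_beta' by measurable
qed

lemma h_measurable1: "x \<in> space (E (Suc n)) \<Longrightarrow> (\<lambda>y. h n y x) \<in> borel_measurable (E n)"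
  using measurable_Pair1[OF h_measurable] by simp

lemma h_pos: "y \<in> space (E n) \<Longrightarrow> x \<in> space (E (Suc n)) \<Longrightarrow> 0 < h n y x"
  by (simp add: h_def G_pos H_pos)

lemma D_measurable [measurable]: "D n \<in> borel_measurable (E (Suc n))"
proof -
  interpret e: prob_space "\<eta> n" by (rule prob_eta)
  have "(\<lambda>(x, y). h n y x) \<in> borel_measurable (E (Suc n) \<Otimes>\<^sub>M \<eta> n)"
    by measurable
  from e.borel_measurable_nn_integral[OF this] show ?thesis by (simp add: D_def[abs_def])
qed

text \<open>A strictly positive integrand has positive integral against a probability, so the
  backward kernel never divides by zero.\<close>

lemma D_nonzero:
  assumes x: "x \<in> space (E (Suc n))"
  shows "D n x \<noteq> 0"
proof
  interpret e: prob_space "\<eta> n" by (rule prob_eta)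
  assume "D n x = 0"
  then have "AE y in \<eta> n. h n y x = 0"
    unfolding D_def
    by (subst (asm) nn_integral_0_iff_AE) (simp_all add: h_measurable1[OF x] cong: measurable_cong_sets)
  moreover have "AE y in \<eta> n. h n y x \<noteq> 0"
    using h_pos[OF _ x] by (intro AE_I2) (auto simp: less_le)
  ultimately have "AE y in \<eta> n. False" by eventually_elim simp
  then show False by simp
qed

lemma K_eq: "K n x = (if D n x < \<infinity> then density (\<eta> n) (\<lambda>y. h n y x / D n x) else \<nu> n x)"
  by (simp add: backward_kernel_def D_def h_def Let_def)

text \<open>Where \<open>D n x\<close> is finite the mass is \<open>D n x / D n x\<close>; elsewhere
  \<open>\<nu> n x\<close> takes over. The mass of a fixed set is measurable in \<open>x\<close>
  because both branches are and the set where \<open>D n\<close> is finite is measurable.\<close>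

lemma K_measurable: "K n \<in> E (Suc n) \<rightarrow>\<^sub>M subprob_algebra (E n)"
proof (rule measurable_subprob_algebra)
  interpret e: prob_space "\<eta> n" by (rule prob_eta)
  have \<nu>: "\<nu> n \<in> E (Suc n) \<rightarrow>\<^sub>M subprob_algebra (E n)"
    by (rule measurable_prob_algebraD[OF \<nu>_prob])
  {
    fix x assume x: "x \<in> space (E (Suc n))"
    show "sets (K n x) = sets (E n)"
      by (simp add: K_eq sets_kernel[OF \<nu> x])
    have "emeasure (K n x) (space (K n x)) \<le> 1" if fin: "D n x < \<infinity>"
    proof -
      have [measurable]: "(\<lambda>y. h n y x) \<in> borel_measurable (E n)" by (rule h_measurable1[OF x])
      have "emeasure (K n x) (space (K n x))
          = (\<integral>\<^sup>+y. h n y x / D n x * indicator (space (E n)) y \<partial>\<eta> n)"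
        using fin by (simp add: K_eq emeasure_density)
      also have "\<dots> = (\<integral>\<^sup>+y. h n y x / D n x \<partial>\<eta> n)"
        by (intro nn_integral_cong) simp
      also have "\<dots> = D n x / D n x"
        unfolding D_def by (rule nn_integral_divide) measurable
      finally show ?thesis using fin D_nonzero[OF x] by (simp add: ennreal_divide_self)
    qed
    then show "subprob_space (K n x)"
      using subprob_space_kernel[OF \<nu> x]
      by (cases "D n x < \<infinity>") (auto simp: K_eq space_E_nonempty intro!: subprob_spaceI)
  }
  fix A assume A [measurable]: "A \<in> sets (E n)"
  have "(\<lambda>(x, y). h n y x / D n x * indicator A y) \<in> borel_measurable (E (Suc n) \<Otimes>\<^sub>M \<eta> n)"
    by measurable
  from e.borel_measurable_nn_integral[OF this]
  have "(\<lambda>x. if D n x < \<infinity> then \<integral>\<^sup>+y. h n y x / D n x * indicator A y \<partial>\<eta> n else emeasure (\<nu> n x) A)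
      \<in> borel_measurable (E (Suc n))"
    by (intro measurable_If measurable_compose[OF \<nu> measurable_emeasure_subprob_algebra]) auto
  then show "(\<lambda>x. emeasure (K n x) A) \<in> borel_measurable (E (Suc n))"
    by (rule measurable_cong[THEN iffD1, rotated])
       (simp add: K_eq emeasure_density h_measurable1 cong: measurable_cong_sets)
qed

section \<open>Duality of forward and backward transitions\<close>

lemma nn_integral_Q_density:
  assumes y: "y \<in> space (E n)" and f [measurable]: "f \<in> borel_measurable (E (Suc n))"
  shows "(\<integral>\<^sup>+x. f x \<partial>Q (Suc n) y) = (\<integral>\<^sup>+x. h n y x * f x \<partial>lam (Suc n))"
proof -
  have [measurable]: "H (Suc n) y \<in> borel_measurable (E (Suc n))"
    using measurable_Pair2[OF H_meas y] by simp
  show ?thesis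
    unfolding nn_integral_Q[OF y f] M_density[OF y] h_def
    by (subst nn_integral_density)
       (simp_all add: nn_integral_cmult[symmetric] ennreal_mult' G_pos[OF y] less_imp_le mult.assoc
         lam_sets cong: measurable_cong_sets)
qed

text \<open>Tonelli, available because \<open>\<gamma> n\<close> is finite and
  \<open>lam (Suc n)\<close> is sigma-finite. The resulting double integral is the common value of
  the two sides of \<open>duality\<close>.\<close>

lemma nn_integral_gamma_Q:
  assumes g [measurable]: "case_prod g \<in> borel_measurable (E n \<Otimes>\<^sub>M E (Suc n))"
  shows "(\<integral>\<^sup>+y. \<integral>\<^sup>+x. g y x \<partial>Q (Suc n) y \<partial>\<gamma> n) = (\<integral>\<^sup>+x. \<integral>\<^sup>+y. h n y x * g y x \<partial>\<gamma> n \<partial>lam (Suc n))"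
proof -
  note lam_sets[measurable_cong]
  interpret g: subprob_space "\<gamma> n" by (rule subprob_gamma)
  interpret l: sigma_finite_measure "lam (Suc n)" by (rule lam_sigma_finite)
  interpret gl: pair_sigma_finite "\<gamma> n" "lam (Suc n)" ..
  have "(\<integral>\<^sup>+y. \<integral>\<^sup>+x. g y x \<partial>Q (Suc n) y \<partial>\<gamma> n) = (\<integral>\<^sup>+y. \<integral>\<^sup>+x. h n y x * g y x \<partial>lam (Suc n) \<partial>\<gamma> n)"
    using measurable_Pair2[OF g] by (intro nn_integral_cong nn_integral_Q_density) auto
  also have "\<dots> = (\<integral>\<^sup>+x. \<integral>\<^sup>+y. h n y x * g y x \<partial>\<gamma> n \<partial>lam (Suc n))"
    by (rule gl.Fubini'[symmetric]) measurable
  finally show ?thesis .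
qed

text \<open>One weighted step for a function of the last state gives the recursion
  \<open>\<gamma> (Suc n) = \<gamma> n Q (Suc n)\<close>; Tonelli then exhibits the unnormalised
  denominator of the backward kernel as a density of \<open>\<gamma> (Suc n)\<close>.\<close>

lemma nn_integral_gamma_Suc:
  assumes f [measurable]: "f \<in> borel_measurable (E (Suc n))"
  shows "(\<integral>\<^sup>+x. f x \<partial>\<gamma> (Suc n)) = (\<integral>\<^sup>+x. (\<integral>\<^sup>+y. h n y x \<partial>\<gamma> n) * f x \<partial>lam (Suc n))"
proof -
  have "(\<integral>\<^sup>+x. f x \<partial>\<gamma> (Suc n))
      = (\<integral>\<^sup>+\<omega>. ennreal (W n \<omega>) * (\<integral>\<^sup>+x. f x \<partial>Q (Suc n) (X n \<omega>)) \<partial>P)"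
    unfolding nn_integral_gamma[OF f] using weighted_step[of n n "\<lambda>_. f"] by simp
  also have "\<dots> = (\<integral>\<^sup>+y. \<integral>\<^sup>+x. f x \<partial>Q (Suc n) y \<partial>\<gamma> n)"
    by (rule nn_integral_gamma[symmetric])
       (rule nn_integral_measurable_subprob_algebra2[OF _ Q_measurable], measurable)
  also have "\<dots> = (\<integral>\<^sup>+x. \<integral>\<^sup>+y. h n y x * f x \<partial>\<gamma> n \<partial>lam (Suc n))"
    by (rule nn_integral_gamma_Q) measurable
  also have "\<dots> = (\<integral>\<^sup>+x. (\<integral>\<^sup>+y. h n y x \<partial>\<gamma> n) * f x \<partial>lam (Suc n))"
    by (intro nn_integral_cong nn_integral_multc)
       (simp add: sets_eq_imp_space_eq[OF lam_sets] h_measurable1 cong: measurable_cong_sets)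
  finally show ?thesis .
qed

text \<open>\<open>\<eta> n\<close> is \<open>\<gamma> n\<close> times the constant
  \<open>1 / ?Z\<close>, which occurs in numerator and denominator of the backward kernel and
  cancels. The multiplied form matches the density of \<open>\<gamma> (Suc n)\<close>.\<close>

lemma nn_integral_K:
  assumes x: "x \<in> space (E (Suc n))" and fin: "(\<integral>\<^sup>+y. h n y x \<partial>\<gamma> n) < \<infinity>"
    and f [measurable]: "f \<in> borel_measurable (E n)"
  shows "(\<integral>\<^sup>+y. h n y x \<partial>\<gamma> n) * (\<integral>\<^sup>+y. f y \<partial>K n x) = (\<integral>\<^sup>+y. h n y x * f y \<partial>\<gamma> n)"
proof -
  let ?Z = "emeasure (\<gamma> n) (space (E n))" and ?D = "\<integral>\<^sup>+y. h n y x \<partial>\<gamma> n"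
  have [measurable]: "(\<lambda>y. h n y x) \<in> borel_measurable (E n)" by (rule h_measurable1[OF x])
  \<comment> \<open>As \<open>?Z\<close> is neither 0 nor infinite, finiteness of \<open>?D\<close>
    carries over to \<open>D n x\<close>, and \<open>K n x\<close> is the density and not
    \<open>\<nu> n x\<close>.\<close>
  have Z: "?Z \<noteq> 0" "?Z \<noteq> \<top>"
    using gamma_total_nonzero gamma_total_le_1[of n] by (auto simp: top_unique)
  have D: "D n x = 1 / ?Z * ?D"
    unfolding D_def by (rule nn_integral_eta) measurable
  moreover have "1 / ?Z < \<top>"
    using Z by (simp add: ennreal_divide_eq_top_iff less_top[symmetric])
  ultimately have D_fin: "D n x < \<infinity>"
    using fin by (simp add: ennreal_mult_less_top)
  have "(\<integral>\<^sup>+y. f y \<partial>K n x) = (\<integral>\<^sup>+y. h n y x / D n x * f y \<partial>\<eta> n)"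
    using D_fin by (simp add: K_eq nn_integral_density)
  also have "\<dots> = (\<integral>\<^sup>+y. h n y x * f y / D n x \<partial>\<eta> n)"
    by (simp add: ennreal_divide_times mult.commute ennreal_times_divide)
  also have "\<dots> = (\<integral>\<^sup>+y. h n y x * f y \<partial>\<eta> n) / D n x"
    by (rule nn_integral_divide) measurable
  also have "\<dots> = 1 / ?Z * (\<integral>\<^sup>+y. h n y x * f y \<partial>\<gamma> n) / D n x"
    by (subst nn_integral_eta) auto
  \<comment> \<open>Rearranged so that the first factor becomes \<open>D n x / D n x\<close>, which
    is 1.\<close>
  finally have "?D * (\<integral>\<^sup>+y. f y \<partial>K n x) = (1 / ?Z * ?D) / D n x * (\<integral>\<^sup>+y. h n y x * f y \<partial>\<gamma> n)"
    by (simp add: divide_ennreal_def mult_ac)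
  also have "\<dots> = (\<integral>\<^sup>+y. h n y x * f y \<partial>\<gamma> n)"
    using D_nonzero[OF x] D_fin by (simp add: D[symmetric] ennreal_divide_self)
  finally show ?thesis .
qed

text \<open>Bayes' rule for the states at times \<open>n\<close> and \<open>Suc n\<close>. Test
  functions of both states are needed because the backward induction uses it with the earlier path
  already integrated into \<open>g\<close>.\<close>

lemma duality:
  assumes g [measurable]: "case_prod g \<in> borel_measurable (E n \<Otimes>\<^sub>M E (Suc n))"
  shows "(\<integral>\<^sup>+x. \<integral>\<^sup>+y. g y x \<partial>K n x \<partial>\<gamma> (Suc n)) = (\<integral>\<^sup>+y. \<integral>\<^sup>+x. g y x \<partial>Q (Suc n) y \<partial>\<gamma> n)"
proof -
  note lam_sets[measurable_cong]
  interpret g: subprob_space "\<gamma> n" by (rule subprob_gamma)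
  let ?D = "\<lambda>x. \<integral>\<^sup>+y. h n y x \<partial>\<gamma> n"
  have sp: "space (lam (Suc n)) = space (E (Suc n))"
    by (rule sets_eq_imp_space_eq[OF lam_sets])
  have "(\<lambda>(x, y). h n y x) \<in> borel_measurable (E (Suc n) \<Otimes>\<^sub>M \<gamma> n)"
    by measurable
  from g.borel_measurable_nn_integral[OF this] have D [measurable]: "?D \<in> borel_measurable (E (Suc n))"
    by simp
  have "(\<integral>\<^sup>+x. ?D x \<partial>lam (Suc n)) = emeasure (\<gamma> (Suc n)) (space (E (Suc n)))"
    using nn_integral_gamma_Suc[of "\<lambda>_. 1" n] by simp
  \<comment> \<open>The integral of \<open>?D\<close> is the total mass of
    \<open>\<gamma> (Suc n)\<close>, at most 1, so \<open>?D\<close> is finite almost everywhere and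
    \<open>nn_integral_K\<close> applies off a null set.\<close>
  then have "(\<integral>\<^sup>+x. ?D x \<partial>lam (Suc n)) \<noteq> \<infinity>"
    using gamma_total_le_1[of "Suc n"] by (auto simp: top_unique)
  then have fin: "AE x in lam (Suc n). ?D x \<noteq> \<infinity>"
    by (intro nn_integral_PInf_AE) auto
  have [measurable]: "(\<lambda>x. \<integral>\<^sup>+y. g y x \<partial>K n x) \<in> borel_measurable (E (Suc n))"
    by (rule nn_integral_measurable_subprob_algebra2[OF _ K_measurable]) measurable
  have "(\<integral>\<^sup>+x. \<integral>\<^sup>+y. g y x \<partial>K n x \<partial>\<gamma> (Suc n)) = (\<integral>\<^sup>+x. ?D x * (\<integral>\<^sup>+y. g y x \<partial>K n x) \<partial>lam (Suc n))"
    by (rule nn_integral_gamma_Suc) measurable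
  also have "\<dots> = (\<integral>\<^sup>+x. \<integral>\<^sup>+y. h n y x * g y x \<partial>\<gamma> n \<partial>lam (Suc n))"
  proof (rule nn_integral_cong_AE, use fin AE_space in eventually_elim)
    fix x assume "?D x \<noteq> \<infinity>" "x \<in> space (lam (Suc n))"
    then show "?D x * (\<integral>\<^sup>+y. g y x \<partial>K n x) = (\<integral>\<^sup>+y. h n y x * g y x \<partial>\<gamma> n)"
      using measurable_Pair1[OF g] by (intro nn_integral_K) (auto simp: sp less_top)
  qed
  also have "\<dots> = (\<integral>\<^sup>+y. \<integral>\<^sup>+x. g y x \<partial>Q (Suc n) y \<partial>\<gamma> n)"
    by (rule nn_integral_gamma_Q[OF g, symmetric])
  finally show ?thesis .
qed

section \<open>The backward product\<close>

text \<open>Both clauses of the recursion yield the empty path here: at a successor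
  \<open>Suc m\<close> the guard \<open>Suc m \<le> m\<close> fails.\<close>

lemma B_same: "B n n x = return (Pi\<^sub>M {} E) (\<lambda>_. undefined)"
  by (cases n) (simp_all add: FK_backward_def)

lemma B_Suc: "r \<le> n \<Longrightarrow> B (Suc n) r x = K n x \<bind>
     (\<lambda>y. distr (B n r y) (Pi\<^sub>M {r..<Suc n} E) (\<lambda>z. z(n := y)))"
  by (simp add: FK_backward_def)

text \<open>Upward induction on \<open>n\<close>, in contrast to \<open>F\<close>: this recursion
  peels off the transition out of the terminal time.\<close>

lemma B_measurable: "r \<le> n \<Longrightarrow> B n r \<in> E n \<rightarrow>\<^sub>M subprob_algebra (Pi\<^sub>M {r..<n} E)"
proof (induction n rule: dec_induct)
  case base
  have "return (Pi\<^sub>M {} E) (\<lambda>_. undefined) \<in> space (subprob_algebra (Pi\<^sub>M {} E))"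
    by (rule measurable_space[OF return_measurable]) (simp add: space_PiM)
  moreover have "B r r = (\<lambda>_. return (Pi\<^sub>M {} E) (\<lambda>_. undefined))"
    by (rule ext) (rule B_same)
  ultimately show ?case by simp
next
  case (step n)
  show ?case
    unfolding B_Suc[OF step.hyps(1), abs_def]
    by (rule measurable_bind2[OF K_measurable kernel_extend[OF atLeastLessThanSuc[of r n, THEN trans] step.IH]])
       (use step.hyps in simp)
qed

text \<open>In the induction step \<open>duality\<close> trades the backward transition out of time
  \<open>Suc n\<close> for a forward one. The hypothesis is then applied to \<open>f\<close> with
  its last coordinate integrated against \<open>Q (Suc n)\<close>, which is why \<open>f\<close> is
  generalised.\<close>

lemma nn_integral_backward:
  assumes "r \<le> n" "f \<in> borel_measurable (Pi\<^sub>M {r..n} E)"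
  shows "(\<integral>\<^sup>+x. \<integral>\<^sup>+z. f (z(n := x)) \<partial>B n r x \<partial>\<gamma> n) = (\<integral>\<^sup>+\<omega>. ennreal (W n \<omega>) * f (traj r n \<omega>) \<partial>P)"
  using assms
proof (induction n arbitrary: f rule: dec_induct)
  case base
  have upd: "(\<lambda>x. (\<lambda>_. undefined)(r := x)) \<in> E r \<rightarrow>\<^sub>M Pi\<^sub>M {r..r} E"
    by (intro measurable_fun_upd[where J="{}"]) (auto simp: space_PiM)
  have f [measurable]: "(\<lambda>x. f ((\<lambda>_. undefined)(r := x))) \<in> borel_measurable (E r)"
    by (rule measurable_compose[OF upd base])
  have tr: "(\<lambda>_. undefined)(r := X r \<omega>) = traj r r \<omega>" for \<omega>
    by (auto simp: fun_eq_iff)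
  have "(\<integral>\<^sup>+z. f (z(r := x)) \<partial>B r r x) = f ((\<lambda>_. undefined)(r := x))" for x
    unfolding B_same by (subst nn_integral_return) (auto simp: space_PiM PiM_empty)
  then have "(\<integral>\<^sup>+x. \<integral>\<^sup>+z. f (z(r := x)) \<partial>B r r x \<partial>\<gamma> r) = (\<integral>\<^sup>+x. f ((\<lambda>_. undefined)(r := x)) \<partial>\<gamma> r)"
    by simp
  also have "\<dots> = (\<integral>\<^sup>+\<omega>. ennreal (W r \<omega>) * f (traj r r \<omega>) \<partial>P)"
    unfolding nn_integral_gamma[OF f] tr ..
  finally show ?case .
next
  case (step n)
  note f = step.prems
  have rn: "r \<le> n" by (rule step.hyps)
  have ins: "{r..<Suc n} = insert n {r..<n}" "{r..n} = insert n {r..<n}" "{r..Suc n} = insert (Suc n) {r..n}"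
    and ins': "{r..Suc n} = insert (Suc n) {r..<Suc n}"
    using rn by auto
  let ?J = "Pi\<^sub>M {r..<n} E"
  \<comment> \<open>The integrands of \<open>g\<close> and of the Fubini exchange arise from this
    map by permuting or fixing arguments.\<close>
  have upd: "(\<lambda>u. (fst (fst u))(n := snd (fst u), Suc n := snd u)) \<in> (?J \<Otimes>\<^sub>M E n) \<Otimes>\<^sub>M E (Suc n) \<rightarrow>\<^sub>M Pi\<^sub>M {r..Suc n} E"
    unfolding ins(3) by (intro measurable_fun_upd[where J="{r..n}"] measurable_fun_upd[where J="{r..<n}"]) (auto simp: ins(2))
  note fu [measurable] = measurable_compose[OF upd f]
  have [measurable]: "(\<lambda>u. B n r (fst u)) \<in> E n \<Otimes>\<^sub>M E (Suc n) \<rightarrow>\<^sub>M subprob_algebra ?J"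
    by (rule measurable_compose[OF measurable_fst B_measurable[OF rn]])
  \<comment> \<open>All coordinates before time \<open>n\<close> are integrated out, so only the two
    states related by \<open>duality\<close> remain.\<close>
  define g where "g y x = (\<integral>\<^sup>+z. f (z(n := y, Suc n := x)) \<partial>B n r y)" for y x
  have g: "case_prod g \<in> borel_measurable (E n \<Otimes>\<^sub>M E (Suc n))"
  proof -
    have "(\<lambda>v. f ((snd v)(n := fst (fst v), Suc n := snd (fst v)))) \<in> borel_measurable ((E n \<Otimes>\<^sub>M E (Suc n)) \<Otimes>\<^sub>M ?J)"
      by (rule measurable_compose[where f="\<lambda>v. ((snd v, fst (fst v)), snd (fst v))", OF _ fu,
            unfolded fst_conv snd_conv]) measurable
    then show ?thesis
      unfolding g_def split_beta'
      by (intro nn_integral_measurable_subprob_algebra2[where N="?J"]) (auto simp: split_beta')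
  qed
  have fh: "(\<lambda>u. f ((fst u)(Suc n := snd u))) \<in> borel_measurable (Pi\<^sub>M {r..n} E \<Otimes>\<^sub>M E (Suc n))"
    by (intro measurable_compose[OF measurable_fun_upd f]) (auto simp: ins(3))
  \<comment> \<open>The test function for the induction hypothesis: the last state is drawn from
    \<open>Q (Suc n)\<close> started at coordinate \<open>n\<close> of the path.\<close>
  have Qf: "(\<lambda>w. \<integral>\<^sup>+x. f (w(Suc n := x)) \<partial>Q (Suc n) (w n)) \<in> borel_measurable (Pi\<^sub>M {r..n} E)"
  proof (rule nn_integral_measurable_subprob_algebra2[where N="E (Suc n)"])
    show "(\<lambda>(w, x). f (w(Suc n := x))) \<in> borel_measurable (Pi\<^sub>M {r..n} E \<Otimes>\<^sub>M E (Suc n))"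
      using fh by (simp only: split_beta')
    show "(\<lambda>w. Q (Suc n) (w n)) \<in> Pi\<^sub>M {r..n} E \<rightarrow>\<^sub>M subprob_algebra (E (Suc n))"
      using rn by (intro measurable_compose[where f="\<lambda>w. w n", OF measurable_component_singleton Q_measurable]) auto
  qed
  have "(\<integral>\<^sup>+x. \<integral>\<^sup>+z. f (z(Suc n := x)) \<partial>B (Suc n) r x \<partial>\<gamma> (Suc n)) = (\<integral>\<^sup>+x. \<integral>\<^sup>+y. g y x \<partial>K n x \<partial>\<gamma> (Suc n))"
  proof (rule nn_integral_cong)
    fix x assume "x \<in> space (\<gamma> (Suc n))"
    then have x: "x \<in> space (E (Suc n))" by simp
    have "(\<lambda>w. f (w(Suc n := x))) \<in> borel_measurable (Pi\<^sub>M {r..<Suc n} E)"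
      by (intro measurable_compose[OF measurable_fun_upd f]) (use x in \<open>auto simp: ins'\<close>)
    then show "(\<integral>\<^sup>+z. f (z(Suc n := x)) \<partial>B (Suc n) r x) = (\<integral>\<^sup>+y. g y x \<partial>K n x)"
      unfolding B_Suc[OF rn] g_def
      by (rule nn_integral_bind_extend[OF ins(1) B_measurable[OF rn] sets_kernel[OF K_measurable x]])
  qed
  also have "\<dots> = (\<integral>\<^sup>+y. \<integral>\<^sup>+x. g y x \<partial>Q (Suc n) y \<partial>\<gamma> n)"
    by (rule duality[OF g])
  \<comment> \<open>For fixed \<open>y\<close>, \<open>B n r y\<close> and
    \<open>Q (Suc n) y\<close> are subprobabilities independent of each other's variable, so Fubini
    exchanges them.\<close>
  also have "\<dots> = (\<integral>\<^sup>+y. \<integral>\<^sup>+z. \<integral>\<^sup>+x. f (z(n := y, Suc n := x)) \<partial>Q (Suc n) y \<partial>B n r y \<partial>\<gamma> n)"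
  proof (rule nn_integral_cong)
    fix y assume "y \<in> space (\<gamma> n)"
    then have y: "y \<in> space (E n)" by simp
    interpret b: subprob_space "B n r y" by (rule subprob_space_kernel[OF B_measurable[OF rn] y])
    interpret q: subprob_space "Q (Suc n) y" by (rule subprob_space_kernel[OF Q_measurable y])
    interpret bq: pair_sigma_finite "B n r y" "Q (Suc n) y" ..
    note [measurable_cong] = sets_kernel[OF B_measurable[OF rn] y] sets_kernel[OF Q_measurable y]
    have "(\<lambda>u. f ((fst u)(n := y, Suc n := snd u))) \<in> borel_measurable (?J \<Otimes>\<^sub>M E (Suc n))"
      by (rule measurable_compose[where f="\<lambda>u. ((fst u, y), snd u)", OF _ fu, unfolded fst_conv snd_conv])
         (use y in measurable)
    then show "(\<integral>\<^sup>+x. g y x \<partial>Q (Suc n) y) = (\<integral>\<^sup>+z. \<integral>\<^sup>+x. f (z(n := y, Suc n := x)) \<partial>Q (Suc n) y \<partial>B n r y)"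
      unfolding g_def by (intro bq.Fubini') (simp add: split_beta' cong: measurable_cong_sets)
  qed
  \<comment> \<open>Coordinate \<open>n\<close> of the updated path is \<open>y\<close>, so the
    starting point of the transition can be read off the path.\<close>
  also have "\<dots> = (\<integral>\<^sup>+y. \<integral>\<^sup>+z. (\<lambda>w. \<integral>\<^sup>+x. f (w(Suc n := x)) \<partial>Q (Suc n) (w n)) (z(n := y)) \<partial>B n r y \<partial>\<gamma> n)"
    by simp
  also have "\<dots> = (\<integral>\<^sup>+\<omega>. ennreal (W n \<omega>) * (\<lambda>w. \<integral>\<^sup>+x. f (w(Suc n := x)) \<partial>Q (Suc n) (w n)) (traj r n \<omega>) \<partial>P)"
    by (rule step.IH[OF Qf])
  also have "\<dots> = (\<integral>\<^sup>+\<omega>. ennreal (W n \<omega>) * (\<integral>\<^sup>+x. f ((traj r n \<omega>)(Suc n := x)) \<partial>Q (Suc n) (X n \<omega>)) \<partial>P)"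
    using rn by simp
  \<comment> \<open>The weighted step in reverse: the integral over \<open>Q (Suc n)\<close> becomes
    a move of the chain and the weight gains its next factor.\<close>
  also have "\<dots> = (\<integral>\<^sup>+\<omega>. ennreal (W (Suc n) \<omega>) * f ((traj r n \<omega>)(Suc n := X (Suc n) \<omega>)) \<partial>P)"
    by (rule weighted_step[OF rn, symmetric]) (use fh in \<open>simp only: split_beta'\<close>)
  also have "\<dots> = (\<integral>\<^sup>+\<omega>. ennreal (W (Suc n) \<omega>) * f (traj r (Suc n) \<omega>) \<partial>P)"
    using rn by (simp only: traj_Suc[OF le_SucI])
  finally show ?case .
qed

section \<open>The two path space identities\<close>

lemma insert_atLeastLessThan: "p \<le> n \<Longrightarrow> {p..n} = insert n {p..<n}" for p n :: nat
  by auto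

lemma backward_total_measurable:
  "p \<le> n \<Longrightarrow> (\<lambda>x. distr (B n p x) (Pi\<^sub>M {p..n} E) (\<lambda>z. z(n := x))) \<in> E n \<rightarrow>\<^sub>M subprob_algebra (Pi\<^sub>M {p..n} E)"
  by (rule kernel_extend[OF insert_atLeastLessThan B_measurable])

text \<open>The instances \<open>r = p\<close> of \<open>nn_integral_forward\<close> and
  \<open>nn_integral_backward\<close> share their right-hand side.\<close>

lemma forward_eq_backward:
  assumes "p \<le> n"
  shows "\<gamma> p \<bind> (\<lambda>x. distr (F p n x) (Pi\<^sub>M {p..n} E) (\<lambda>z. z(p := x)))
    = \<gamma> n \<bind> (\<lambda>x. distr (B n p x) (Pi\<^sub>M {p..n} E) (\<lambda>z. z(n := x)))"
proof (rule nn_integral_eq_imp_measure_eq)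
  have I: "{p..n} = insert p {p<..n}" using assms by auto
  have KF: "(\<lambda>x. distr (F p n x) (Pi\<^sub>M {p..n} E) (\<lambda>z. z(p := x))) \<in> \<gamma> p \<rightarrow>\<^sub>M subprob_algebra (Pi\<^sub>M {p..n} E)"
    using kernel_extend[OF I F_measurable[OF assms]] by (simp cong: measurable_cong_sets)
  show "sets (\<gamma> p \<bind> (\<lambda>x. distr (F p n x) (Pi\<^sub>M {p..n} E) (\<lambda>z. z(p := x)))) = sets (Pi\<^sub>M {p..n} E)"
    by (rule sets_bind_measurable[OF KF]) (simp add: space_E_nonempty)
  show "sets (\<gamma> n \<bind> (\<lambda>x. distr (B n p x) (Pi\<^sub>M {p..n} E) (\<lambda>z. z(n := x)))) = sets (Pi\<^sub>M {p..n} E)"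
    by (rule sets_bind_measurable)
       (simp_all add: space_E_nonempty backward_total_measurable[OF assms] cong: measurable_cong_sets)
  fix f :: "(nat \<Rightarrow> 'a) \<Rightarrow> ennreal" assume f: "f \<in> borel_measurable (Pi\<^sub>M {p..n} E)"
  \<comment> \<open>Membership of \<open>z\<close> in the product space matters: it makes
    \<open>z\<close> equal to \<open>undefined\<close> off \<open>{p<..n}\<close>, as the merge
    requires.\<close>
  have m: "merge {p..p} {p<..n} (traj p p \<omega>, z) = z(p := X p \<omega>)"
    if "z \<in> space (Pi\<^sub>M {p<..n} E)" for z \<omega>
    using that by (auto simp: fun_eq_iff merge_def space_PiM PiE_def extensional_def)
  have "(\<lambda>(x, z). f (z(p := x))) \<in> borel_measurable (E p \<Otimes>\<^sub>M Pi\<^sub>M {p<..n} E)"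
    using measurable_compose[OF fun_upd_PiM_measurable[OF I] f] by (simp add: split_beta')
  then have F1: "(\<lambda>x. \<integral>\<^sup>+z. f (z(p := x)) \<partial>F p n x) \<in> borel_measurable (E p)"
    by (rule nn_integral_measurable_subprob_algebra2[OF _ F_measurable[OF assms]])
  have "(\<integral>\<^sup>+w. f w \<partial>(\<gamma> p \<bind> (\<lambda>x. distr (F p n x) (Pi\<^sub>M {p..n} E) (\<lambda>z. z(p := x)))))
      = (\<integral>\<^sup>+x. \<integral>\<^sup>+z. f (z(p := x)) \<partial>F p n x \<partial>\<gamma> p)"
    by (rule nn_integral_bind_extend[OF I F_measurable[OF assms] sets_gamma f])
  also have "\<dots> = (\<integral>\<^sup>+\<omega>. ennreal (W p \<omega>) *
      (\<integral>\<^sup>+z. f (merge {p..p} {p<..n} (traj p p \<omega>, z)) \<partial>F p n (X p \<omega>)) \<partial>P)"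
    unfolding nn_integral_gamma[OF F1]
    using sets_eq_imp_space_eq[OF sets_kernel[OF F_measurable[OF assms] X_in_space]]
    by (intro nn_integral_cong arg_cong2[where f="(*)"] refl) (simp only: m)
  also have "\<dots> = (\<integral>\<^sup>+\<omega>. ennreal (W n \<omega>) * f (traj p n \<omega>) \<partial>P)"
    by (rule nn_integral_forward[OF order_refl assms f])
  also have "\<dots> = (\<integral>\<^sup>+x. \<integral>\<^sup>+z. f (z(n := x)) \<partial>B n p x \<partial>\<gamma> n)"
    by (rule nn_integral_backward[OF assms f, symmetric])
  also have "\<dots> = (\<integral>\<^sup>+w. f w \<partial>(\<gamma> n \<bind> (\<lambda>x. distr (B n p x) (Pi\<^sub>M {p..n} E) (\<lambda>z. z(n := x)))))"
    by (rule nn_integral_bind_extend[OF insert_atLeastLessThan[OF assms] B_measurable[OF assms] sets_gamma f, symmetric])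
  finally show "(\<integral>\<^sup>+w. f w \<partial>(\<gamma> p \<bind> (\<lambda>x. distr (F p n x) (Pi\<^sub>M {p..n} E) (\<lambda>z. z(p := x)))))
      = (\<integral>\<^sup>+w. f w \<partial>(\<gamma> n \<bind> (\<lambda>x. distr (B n p x) (Pi\<^sub>M {p..n} E) (\<lambda>z. z(n := x)))))" .
qed

text \<open>The case \<open>r = 0\<close> of \<open>nn_integral_backward\<close>, divided by the
  total mass: the constant passes from the density of the path measure to
  \<open>\<eta> n\<close>.\<close>

lemma FK_path_eq_backward:
  "FK_path P E X G n = \<eta> n \<bind> (\<lambda>x. distr (B n 0 x) (Pi\<^sub>M {0..n} E) (\<lambda>z. z(n := x)))"
proof (rule nn_integral_eq_imp_measure_eq)
  note Bm = B_measurable[of 0 n, simplified]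
  let ?Z = "\<integral>\<omega>. W n \<omega> \<partial>P"
  show "sets (FK_path P E X G n) = sets (Pi\<^sub>M {0..n} E)"
    by (simp add: FK_path_def)
  show "sets (\<eta> n \<bind> (\<lambda>x. distr (B n 0 x) (Pi\<^sub>M {0..n} E) (\<lambda>z. z(n := x)))) = sets (Pi\<^sub>M {0..n} E)"
    by (rule sets_bind_measurable)
       (simp_all add: space_E_nonempty backward_total_measurable cong: measurable_cong_sets)
  fix f :: "(nat \<Rightarrow> 'a) \<Rightarrow> ennreal" assume f [measurable]: "f \<in> borel_measurable (Pi\<^sub>M {0..n} E)"
  have "integrable P (W n)"
    by (rule integrable_const_bound[where B=1]) (auto simp: W_nonneg W_le_1)
  \<comment> \<open>The real normaliser in \<open>FK_path\<close> and the \<open>ennreal\<close> one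
    in \<open>FK_eta\<close> are the same number; its positivity justifies the division in
    \<open>ennreal\<close>.\<close>
  then have Z: "emeasure (\<gamma> n) (space (E n)) = ennreal ?Z"
    unfolding emeasure_gamma_space by (rule nn_integral_eq_integral) (auto simp: W_nonneg)
  then have Z_pos: "0 < ?Z"
    using gamma_total_nonzero[of n] by (auto simp: ennreal_eq_0_iff not_le)
  have "(\<lambda>(x, z). f (z(n := x))) \<in> borel_measurable (E n \<Otimes>\<^sub>M Pi\<^sub>M {0..<n} E)"
    using measurable_compose[OF fun_upd_PiM_measurable[OF insert_atLeastLessThan] f] by (simp add: split_beta')
  then have B1: "(\<lambda>x. \<integral>\<^sup>+z. f (z(n := x)) \<partial>B n 0 x) \<in> borel_measurable (E n)"
    by (rule nn_integral_measurable_subprob_algebra2[OF _ Bm])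
  have "(\<integral>\<^sup>+w. f w \<partial>FK_path P E X G n) = (\<integral>\<^sup>+\<omega>. ennreal (W n \<omega> / ?Z) * f (traj 0 n \<omega>) \<partial>P)"
    unfolding FK_path_def by (subst nn_integral_distr) (auto simp: nn_integral_density)
  also have "\<dots> = (\<integral>\<^sup>+\<omega>. 1 / ennreal ?Z * (ennreal (W n \<omega>) * f (traj 0 n \<omega>)) \<partial>P)"
    using Z_pos W_nonneg
    by (intro nn_integral_cong) (simp add: divide_ennreal[symmetric] divide_ennreal_def mult_ac)
  also have "\<dots> = 1 / ennreal ?Z * (\<integral>\<^sup>+\<omega>. ennreal (W n \<omega>) * f (traj 0 n \<omega>) \<partial>P)"
    by (rule nn_integral_cmult) measurable
  also have "\<dots> = (\<integral>\<^sup>+x. \<integral>\<^sup>+z. f (z(n := x)) \<partial>B n 0 x \<partial>\<eta> n)"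
    unfolding nn_integral_eta[OF B1] Z by (simp add: nn_integral_backward[OF _ f])
  also have "\<dots> = (\<integral>\<^sup>+w. f w \<partial>(\<eta> n \<bind> (\<lambda>x. distr (B n 0 x) (Pi\<^sub>M {0..n} E) (\<lambda>z. z(n := x)))))"
    by (rule nn_integral_bind_extend[OF insert_atLeastLessThan Bm sets_eta f, symmetric]) simp
  finally show "(\<integral>\<^sup>+w. f w \<partial>FK_path P E X G n)
      = (\<integral>\<^sup>+w. f w \<partial>(\<eta> n \<bind> (\<lambda>x. distr (B n 0 x) (Pi\<^sub>M {0..n} E) (\<lambda>z. z(n := x)))))" .
qed

end

theorem lemma4p1:
  fixes E :: "nat \<Rightarrow> 'a measure"
    and P :: "'w measure"
    and X :: "nat \<Rightarrow> 'w \<Rightarrow> 'a"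
    and \<eta>0 :: "'a measure"
    and M :: "nat \<Rightarrow> 'a \<Rightarrow> 'a measure"
    and G :: "nat \<Rightarrow> 'a \<Rightarrow> real"
    and H :: "nat \<Rightarrow> 'a \<Rightarrow> 'a \<Rightarrow> real"
    and lam :: "nat \<Rightarrow> 'a measure"
    and \<nu> :: "nat \<Rightarrow> 'a \<Rightarrow> 'a measure"
  assumes chain: "markov_chain P E X \<eta>0 M"
    and G_meas: "\<And>n. G n \<in> borel_measurable (E n)"
    and G_range: "\<And>n. G n \<in> space (E n) \<rightarrow> {0<..1}"
    and lam_sigma_finite: "\<And>n. sigma_finite_measure (lam (Suc n))"
    and lam_sets: "\<And>n. sets (lam (Suc n)) = sets (E (Suc n))"
    and H_meas: "\<And>n. (\<lambda>(x, y). H (Suc n) x y) \<in> borel_measurable (E n \<Otimes>\<^sub>M E (Suc n))"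
    and H_pos: "\<And>n x y. x \<in> space (E n) \<Longrightarrow> y \<in> space (E (Suc n)) \<Longrightarrow> 0 < H (Suc n) x y"
    and M_density: "\<And>n x. x \<in> space (E n) \<Longrightarrow>
          M (Suc n) x = density (lam (Suc n)) (\<lambda>y. ennreal (H (Suc n) x y))"
    and \<nu>_prob: "\<And>n. \<nu> n \<in> E (Suc n) \<rightarrow>\<^sub>M prob_algebra (E n)"
  shows "(\<forall>p n. p < n \<longrightarrow>
            FK_gamma P E X G p \<bind>
              (\<lambda>x. distr (FK_forward E G M p n x) (Pi\<^sub>M {p..n} E) (\<lambda>z. z(p := x)))
          = FK_gamma P E X G n \<bind>
              (\<lambda>x. distr (FK_backward P E X G H \<nu> n p x) (Pi\<^sub>M {p..n} E) (\<lambda>z. z(n := x))))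
       \<and> (\<forall>n. FK_path P E X G n
          = FK_eta P E X G n \<bind>
              (\<lambda>x. distr (FK_backward P E X G H \<nu> n 0 x) (Pi\<^sub>M {0..n} E) (\<lambda>z. z(n := x))))"
proof -
  interpret feynman_kac_density E P X \<eta>0 M G H lam \<nu>
    by (intro feynman_kac_density.intro feynman_kac.intro feynman_kac_density_axioms.intro) (fact assms)+
  show ?thesis
    using forward_eq_backward FK_path_eq_backward by auto
qed

end
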